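(* Consider $(\mathbb C^4,\Omega_0,\omega_0)$ with its canonical $SU(4)$-structure and with holomorphic Euler vector field $\xi=\sum_{j=1}^4 z_j\partial_{z_j}$. Let $M=(m_{ij})_{1\le i,j\le 4}$ be a skew-symmetric invertible $4\times4$ complex matrix, and let $\alpha_M:={}^tZ\,M\,dZ=\sum_{i,j}z_im_{ij}dz_j$ be the corresponding holomorphic twist form of charge $2$ on $\mathbb C^4\setminus\{0\}$. Then the forms $$\Omega_M:=\frac{1}{\|\alpha_M\|^2}\,\overline{\alpha_M}\wedge\big(\overline{\alpha_M}\cdot(\iota_\xi\Omega_0)\big),\qquad \omega_M:=\omega_0-\frac{i}{\|\alpha_M\|^2}\,\alpha_M\wedge\overline{\alpha_M}$$ define an $SU(3)$-structure on $\mathbb{CP}^3$.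
   Context: $\omega_0=\frac i2\sum_{j=1}^4dz_j\wedge d\overline{z_j}$ and $\Omega_0=dz_1\wedge dz_2\wedge dz_3\wedge dz_4$ on $\mathbb C^4$, with the standard Hermitian metric. $SU(m)$-structure: on a smooth manifold of real dimension $2m$, a pair $(\Omega,\omega)$ with $\omega$ a nondegenerate real $2$-form and $\Omega$ a locally decomposable nowhere-vanishing complex $m$-form such that $\Omega\wedge\omega=0$ and $\Omega\wedge\overline\Omega=c_m\omega^m$, where $c_m=\frac{2^m}{m!}(-i)^{m^2}$. A form on $\mathbb C^4\setminus\{0\}$ defines a form on $\mathbb{CP}^3$ when its pullback to the unit sphere $S^7$ (a regular level set of the moment map of the diagonal $S^1$-action) is the pullback of a form on $\mathbb{CP}^3=S^7/S^1$ under the projection $S^7\to\mathbb{CP}^3$, i.e. when it is basic for the diagonal $S^1$-action. A holomorphic twist form of charge $2$ is a nowhere-vanishing holomorphic $1$-form $\alpha$ with $\alpha(\xi)=0$ and $\mathcal L_\xi\alpha=2\alpha$. Contraction by $1$-forms: with respect to the standard Hermitian metric, for a $(1,0)$-form $\alpha=\sum_ja_jdz_j$ one has $\overline\alpha^\sharp=\sum_j\overline{a_j}\,\partial_{z_j}$, and $\overline\alpha\cdot$ denotes contraction by $\overline\alpha^\sharp$. $\|\alpha\|^2:=\overline\alpha\cdot\alpha=\sum_j|a_j|^2$. *)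

theory Defs
  imports "HOL-Analysis.Analysis"
begin

section \<open>Smooth maps\<close>

primrec Ck_on :: "nat \<Rightarrow> ('a::real_normed_vector \<Rightarrow> 'b::real_normed_vector) \<Rightarrow> 'a set \<Rightarrow> bool" where
  "Ck_on 0 f S \<longleftrightarrow> continuous_on S f"
| "Ck_on (Suc n) f S \<longleftrightarrow> (\<forall>x\<in>S. f differentiable (at x)) \<and>
      (\<forall>v. Ck_on n (\<lambda>x. frechet_derivative f (at x) v) S)"

(* Meant for open S in a finite-dimensional space, where it is the usual notion: all iterated
   directional derivatives exist and are continuous. *)
definition smooth_on :: "('a::real_normed_vector \<Rightarrow> 'b::real_normed_vector) \<Rightarrow> 'a set \<Rightarrow> bool" where
  "smooth_on f S \<longleftrightarrow> (\<forall>n. Ck_on n f S)"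

section \<open>Complex-valued exterior algebra of a real vector space\<close>

(* A complex-valued k-form at a point takes a sequence of vectors, of which only the entries
   0, ..., k - 1 matter. *)
type_synonym 'e cform = "(nat \<Rightarrow> 'e) \<Rightarrow> complex"

definition alternating :: "nat \<Rightarrow> 'e::real_vector cform \<Rightarrow> bool" where
  "alternating k \<eta> \<longleftrightarrow>
     (\<forall>v w. (\<forall>i<k. v i = w i) \<longrightarrow> \<eta> v = \<eta> w) \<and>
     (\<forall>v. \<forall>i<k. linear (\<lambda>x. \<eta> (v(i := x)))) \<and>
     (\<forall>v i j. i < k \<and> j < k \<and> i \<noteq> j \<and> v i = v j \<longrightarrow> \<eta> v = 0)"

(* Determinant convention: for 1-forms, (a wedge b)(u, v) = a(u) b(v) - a(v) b(u). *)
definition wedge :: "nat \<Rightarrow> nat \<Rightarrow> 'e cform \<Rightarrow> 'e cform \<Rightarrow> 'e cform" where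
  "wedge p q \<eta> \<theta> = (\<lambda>v. (\<Sum>\<sigma> | \<sigma> permutes {..<p+q}.
      of_int (sign \<sigma>) * \<eta> (\<lambda>i. v (\<sigma> i)) * \<theta> (\<lambda>i. v (\<sigma> (p + i)))) / (fact p * fact q))"

primrec wedge_one_forms :: "nat \<Rightarrow> (nat \<Rightarrow> 'e cform) \<Rightarrow> 'e cform" where
  "wedge_one_forms 0 \<theta> = (\<lambda>v. 1)"
| "wedge_one_forms (Suc n) \<theta> = wedge n 1 (wedge_one_forms n \<theta>) (\<theta> n)"

primrec two_form_power :: "nat \<Rightarrow> 'e cform \<Rightarrow> 'e cform" where
  "two_form_power 0 \<omega> = (\<lambda>v. 1)"
| "two_form_power (Suc n) \<omega> = wedge (2 * n) 2 (two_form_power n \<omega>) \<omega>"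

definition conj_form :: "'e cform \<Rightarrow> 'e cform" where
  "conj_form \<eta> = (\<lambda>v. cnj (\<eta> v))"

definition pull_form :: "('d \<Rightarrow> 'e) \<Rightarrow> 'e cform \<Rightarrow> 'd cform" where
  "pull_form D \<eta> = (\<lambda>v. \<eta> (\<lambda>i. D (v i)))"

definition interior :: "'e \<Rightarrow> 'e cform \<Rightarrow> 'e cform" where
  "interior a \<eta> = (\<lambda>v. \<eta> (case_nat a v))"

definition smooth_form :: "nat \<Rightarrow> 'e::real_normed_vector set \<Rightarrow> ('e \<Rightarrow> 'e cform) \<Rightarrow> bool" where
  "smooth_form k S \<eta> \<longleftrightarrow>
     (\<forall>x\<in>S. alternating k (\<eta> x)) \<and> (\<forall>v. smooth_on (\<lambda>x. \<eta> x v) S)"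

definition locally_decomposable ::
    "nat \<Rightarrow> 'e::real_normed_vector set \<Rightarrow> ('e \<Rightarrow> 'e cform) \<Rightarrow> bool" where
  "locally_decomposable k S \<eta> \<longleftrightarrow>
     (\<forall>x\<in>S. \<exists>N \<theta>. open N \<and> x \<in> N \<and> N \<subseteq> S \<and> (\<forall>i<k. smooth_form 1 N (\<theta> i)) \<and>
        (\<forall>y\<in>N. \<eta> y = wedge_one_forms k (\<lambda>i. \<theta> i y)))"

section \<open>Smooth manifolds and forms on them\<close>

(* A chart is a pair of its domain and its coordinate map. *)
type_synonym ('a, 'e) chart = "'a set \<times> ('a \<Rightarrow> 'e)"

definition transition :: "('a, 'e) chart \<Rightarrow> ('a, 'e) chart \<Rightarrow> 'e \<Rightarrow> 'e" where
  "transition c d = snd d \<circ> inv_into (fst c) (snd c)"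

(* The topology of M is the one generated by the charts; the third and fourth conditions say
   that it is second countable and Hausdorff. *)
definition smooth_manifold :: "'a set \<Rightarrow> ('a, 'e::euclidean_space) chart set \<Rightarrow> bool" where
  "smooth_manifold M A \<longleftrightarrow>
     (\<forall>c\<in>A. fst c \<subseteq> M \<and> inj_on (snd c) (fst c) \<and> open (snd c ` fst c)) \<and>
     (\<forall>c\<in>A. \<forall>d\<in>A. open (snd c ` (fst c \<inter> fst d)) \<and>
        smooth_on (transition c d) (snd c ` (fst c \<inter> fst d))) \<and>
     (\<exists>B\<subseteq>A. countable B \<and> (\<Union>c\<in>B. fst c) = M) \<and>
     (\<forall>p\<in>M. \<forall>q\<in>M. p \<noteq> q \<longrightarrow> (\<exists>c\<in>A. \<exists>d\<in>A. \<exists>N N'.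
        open N \<and> open N' \<and> p \<in> fst c \<and> snd c p \<in> N \<and> q \<in> fst d \<and> snd d q \<in> N' \<and>
        (fst c \<inter> snd c -` N) \<inter> (fst d \<inter> snd d -` N') = {}))"

(* A k-form is given by its coordinate expressions in all charts of the atlas, related by pullback
   along the transition maps. Values outside the image of a chart are irrelevant. *)
type_synonym ('a, 'e) mform = "('a, 'e) chart \<Rightarrow> 'e \<Rightarrow> 'e cform"

definition manifold_form ::
    "nat \<Rightarrow> ('a, 'e::euclidean_space) chart set \<Rightarrow> ('a, 'e) mform \<Rightarrow> bool" where
  "manifold_form k A \<eta> \<longleftrightarrow>
     (\<forall>c\<in>A. smooth_form k (snd c ` fst c) (\<eta> c)) \<and>
     (\<forall>c\<in>A. \<forall>d\<in>A. \<forall>x \<in> snd c ` (fst c \<inter> fst d).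
        \<eta> c x = pull_form (frechet_derivative (transition c d) (at x)) (\<eta> d (transition c d x)))"

definition SU_const :: "nat \<Rightarrow> complex" where
  "SU_const m = 2 ^ m / fact m * (- \<i>) ^ (m\<^sup>2)"

definition SU_structure :: "'a set \<Rightarrow> ('a, 'e::euclidean_space) chart set \<Rightarrow> nat \<Rightarrow>
    ('a, 'e) mform \<Rightarrow> ('a, 'e) mform \<Rightarrow> bool" where
  "SU_structure M A m \<Omega> \<omega> \<longleftrightarrow>
     smooth_manifold M A \<and> DIM('e) = 2 * m \<and>
     manifold_form m A \<Omega> \<and> manifold_form 2 A \<omega> \<and>
     (\<forall>c\<in>A. locally_decomposable m (snd c ` fst c) (\<Omega> c)) \<and>
     (\<forall>c\<in>A. \<forall>x \<in> snd c ` fst c.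
        (\<forall>v. \<omega> c x v \<in> \<real>) \<and>
        (\<forall>u. u \<noteq> 0 \<longrightarrow> interior u (\<omega> c x) \<noteq> (\<lambda>v. 0)) \<and>
        \<Omega> c x \<noteq> (\<lambda>v. 0) \<and>
        wedge m 2 (\<Omega> c x) (\<omega> c x) = (\<lambda>v. 0) \<and>
        wedge m m (\<Omega> c x) (conj_form (\<Omega> c x)) = (\<lambda>v. SU_const m * two_form_power m (\<omega> c x) v))"

section \<open>Complex projective space as a quotient of the unit sphere\<close>

definition hopf :: "complex^4 \<Rightarrow> (complex^4) set" where
  "hopf p = {u *s p | u. cmod u = 1}"

definition CP3 :: "(complex^4) set set" where
  "CP3 = hopf ` sphere 0 1"

(* Inhomogeneous coordinates z_j / z_k for j different from k, listed in the order given by r;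
   they do not depend on the chosen representative z. *)
definition affine_chart :: "4 \<Rightarrow> (3 \<Rightarrow> 4) \<Rightarrow> ((complex^4) set, complex^3) chart" where
  "affine_chart k r =
     (hopf ` {p \<in> sphere 0 1. p $ k \<noteq> 0},
      \<lambda>P. let z = (SOME z. z \<in> P) in \<chi> j. z $ r j / z $ k)"

definition CP3_atlas :: "((complex^4) set, complex^3) chart set" where
  "CP3_atlas = {affine_chart k r | k r. bij_betw r UNIV (- {k})}"

(* The linear map D is the differential at p of the projection from the unit sphere to CP3, in
   the chart c; it is unique on the tangent space of the sphere, the real orthogonal complement
   of p. *)
definition defines_form ::
    "nat \<Rightarrow> (complex^4 \<Rightarrow> (complex^4) cform) \<Rightarrow> ((complex^4) set, complex^3) mform \<Rightarrow> bool" where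
  "defines_form k \<eta> \<eta>' \<longleftrightarrow>
     smooth_form k (- {0}) \<eta> \<and> manifold_form k CP3_atlas \<eta>' \<and>
     (\<forall>p \<in> sphere 0 1. \<forall>c\<in>CP3_atlas. hopf p \<in> fst c \<longrightarrow>
        (\<exists>D. ((snd c \<circ> hopf) has_derivative D) (at p within sphere 0 1) \<and>
           (\<forall>v. (\<forall>i<k. inner p (v i) = 0) \<longrightarrow>
              \<eta> p v = pull_form D (\<eta>' c (snd c (hopf p))) v)))"

section \<open>Forms and vector fields on complex 4-space\<close>

definition dz :: "4 \<Rightarrow> (complex^4) cform" where
  "dz j = (\<lambda>v. v 0 $ j)"

definition omega0 :: "(complex^4) cform" where
  "omega0 = (\<lambda>v. \<i> / 2 * (\<Sum>j\<in>UNIV. wedge 1 1 (dz j) (conj_form (dz j)) v))"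

definition Omega0 :: "(complex^4) cform" where
  "Omega0 = wedge 3 1 (wedge 2 1 (wedge 1 1 (dz 1) (dz 2)) (dz 3)) (dz 4)"

(* Contraction with the complexified vector sum_j a_j d/dz_j of type (1,0), which is
   (a - i J a) / 2 for the real tangent vector a, where J a = i a. *)
definition interior10 :: "complex^4 \<Rightarrow> (complex^4) cform \<Rightarrow> (complex^4) cform" where
  "interior10 a \<eta> = (\<lambda>v. (interior a \<eta> v - \<i> * interior (\<i> *s a) \<eta> v) / 2)"

(* For a (1,0)-form sum_j a_j dz_j, the coefficients (cnj a_j) of the (1,0)-vector dual to its
   conjugate; a_j is the value of the form on d/dz_j. *)
definition conj_sharp :: "(complex^4) cform \<Rightarrow> complex^4" where
  "conj_sharp \<alpha> = (\<chi> j. cnj (interior10 (axis j 1) \<alpha> (\<lambda>_. 0)))"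

(* The 0-form obtained by contraction does not look at its argument. *)
definition norm_sq :: "(complex^4) cform \<Rightarrow> complex" where
  "norm_sq \<alpha> = interior10 (conj_sharp \<alpha>) \<alpha> (\<lambda>_. 0)"

definition euler :: "complex^4 \<Rightarrow> complex^4" where
  "euler z = z"

definition lie_derivative :: "nat \<Rightarrow> (complex^4 \<Rightarrow> complex^4) \<Rightarrow>
    (complex^4 \<Rightarrow> (complex^4) cform) \<Rightarrow> complex^4 \<Rightarrow> (complex^4) cform" where
  "lie_derivative k X \<eta> z = (\<lambda>v. frechet_derivative (\<lambda>y. \<eta> y v) (at z) (X z) +
     (\<Sum>i<k. \<eta> z (v(i := frechet_derivative X (at z) (v i)))))"

(* Lie derivative along the (1,0)-field sum_j X_j d/dz_j, by complex linearity in the field. *)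
definition lie_derivative10 :: "nat \<Rightarrow> (complex^4 \<Rightarrow> complex^4) \<Rightarrow>
    (complex^4 \<Rightarrow> (complex^4) cform) \<Rightarrow> complex^4 \<Rightarrow> (complex^4) cform" where
  "lie_derivative10 k X \<eta> z =
     (\<lambda>v. (lie_derivative k X \<eta> z v - \<i> * lie_derivative k (\<lambda>y. \<i> *s X y) \<eta> z v) / 2)"

definition holomorphic_one_form ::
    "(complex^4) set \<Rightarrow> (complex^4 \<Rightarrow> (complex^4) cform) \<Rightarrow> bool" where
  "holomorphic_one_form S \<alpha> \<longleftrightarrow>
     (\<forall>z\<in>S. alternating 1 (\<alpha> z) \<and> (\<forall>c v. \<alpha> z (\<lambda>i. c *s v i) = c * \<alpha> z v)) \<and>
     (\<forall>v. \<forall>z\<in>S. \<exists>D. ((\<lambda>y. \<alpha> y v) has_derivative D) (at z) \<and> (\<forall>c h. D (c *s h) = c * D h))"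

definition holomorphic_twist_form ::
    "nat \<Rightarrow> (complex^4 \<Rightarrow> (complex^4) cform) \<Rightarrow> bool" where
  "holomorphic_twist_form q \<alpha> \<longleftrightarrow>
     holomorphic_one_form (- {0}) \<alpha> \<and>
     (\<forall>z \<in> - {0}. \<alpha> z \<noteq> (\<lambda>v. 0) \<and>
        interior10 (euler z) (\<alpha> z) = (\<lambda>v. 0) \<and>
        lie_derivative10 1 euler \<alpha> z = (\<lambda>v. of_nat q * \<alpha> z v))"

definition alpha_form :: "complex^4^4 \<Rightarrow> complex^4 \<Rightarrow> (complex^4) cform" where
  "alpha_form M z = (\<lambda>v. \<Sum>i\<in>UNIV. \<Sum>j\<in>UNIV. z $ i * M $ i $ j * dz j v)"

definition Omega_form :: "complex^4^4 \<Rightarrow> complex^4 \<Rightarrow> (complex^4) cform" where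
  "Omega_form M z = (\<lambda>v. 1 / norm_sq (alpha_form M z) *
     wedge 1 2 (conj_form (alpha_form M z))
       (interior10 (conj_sharp (alpha_form M z)) (interior10 (euler z) Omega0)) v)"

definition omega_form :: "complex^4^4 \<Rightarrow> complex^4 \<Rightarrow> (complex^4) cform" where
  "omega_form M z = (\<lambda>v. omega0 v - \<i> / norm_sq (alpha_form M z) *
     wedge 1 1 (alpha_form M z) (conj_form (alpha_form M z)) v)"

end

theory Submission
  imports Defs
begin

text \<open>Write \<open>h\<close> for the standard Hermitian product, \<open>a = (conjugate of M\<^sup>T z)\<close> for the
vector dual to \<open>\<alpha>\<close> at \<open>z\<close>, so that \<open>\<alpha> = h(\<cdot>, a)\<close> and
\<open>\<parallel>\<alpha>\<parallel>\<^sup>2 = h(a, a)\<close>. Skew-symmetry of \<open>M\<close> says that \<open>a\<close> is orthogonal to \<open>z\<close>, and invertibility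
that \<open>a \<noteq> 0\<close>. Complete \<open>z, a\<close> to an orthogonal basis \<open>z, a, f, g\<close>. On the unit sphere
\<open>\<Omega>\<^sub>M\<close> is, after normalising the vectors, the product of the conjugate of \<open>h(\<cdot>, a)\<close> with \<open>h(\<cdot>, f)\<close>
and \<open>h(\<cdot>, g)\<close>, because contracting \<open>\<Omega>\<^sub>0\<close> with \<open>z\<close> and \<open>a\<close> leaves the volume form of their
orthogonal complement. Subtracting \<open>(i / \<parallel>\<alpha>\<parallel>\<^sup>2) \<alpha> \<and> \<alpha>'\<close> (a prime denotes the conjugate)
from \<open>\<omega>\<^sub>0\<close> reverses the sign of its \<open>a\<close>-component, so modulo the \<open>z\<close>-component \<open>\<omega>\<^sub>M\<close> is
\<open>(i/2) \<Sum> t \<and> t'\<close> over the very same three one-forms \<open>t\<close>. Thus \<open>\<Omega>\<^sub>M\<close> and \<open>\<omega>\<^sub>M\<close>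
are the standard SU(3) pair in an adapted frame (\<open>unitary_frame\<close>, \<open>SU3_conditions\<close>).

To descend, both forms are extended from the sphere to forms on all of \<open>\<complex>\<^sup>4 - {0}\<close> that vanish along
the complex line through \<open>z\<close> and are invariant under all of \<open>\<complex>\<^sup>*\<close>: \<open>\<Omega>\<^sub>M\<close> is divided by \<open>|z|\<^sup>4\<close>,
and \<open>\<omega>\<^sub>0\<close> is replaced by the Fubini-Study form. Such forms can be pulled back along any local lift
of projective space, in particular along the affine lifts, which have constant derivative. Any two
lifts, and the sphere, differ by a rescaling, so the resulting local expressions fit together and
restrict correctly to the sphere (\<open>local_expr_pull\<close>, \<open>defines_form_descend\<close>).

Local decomposability needs one-forms that vary smoothly. The factorisation of the contracted volume form
works for every nonzero \<open>f\<close> orthogonal to \<open>z\<close> and \<open>a\<close>, whatever its length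
(\<open>vol_decompose\<close>), so the orthogonal projection of a fixed vector can serve as \<open>f\<close>, and
everything stays a rational function of the coordinates and their conjugates.\<close>

section \<open>Calculus of smooth maps\<close>

lemma Ck_on_cong:
  assumes "open S" "\<And>x. x \<in> S \<Longrightarrow> f x = g x" "Ck_on n f S"
  shows "Ck_on n g S"
  using assms(2,3)
proof (induction n arbitrary: f g)
  case 0
  then show ?case by (simp cong: continuous_on_cong)
next
  case (Suc n)
  have der: "(g has_derivative frechet_derivative f (at x)) (at x)" if "x \<in> S" for x
    using Suc.prems that assms(1)
    by (auto intro!: has_derivative_transform_within_open[of f _ x UNIV S g]
        simp: frechet_derivative_works)
  have "Ck_on n (\<lambda>x. frechet_derivative g (at x) v) S" for v
  proof (rule Suc.IH)
    show "Ck_on n (\<lambda>x. frechet_derivative f (at x) v) S" using Suc.prems by simp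
    show "frechet_derivative f (at x) v = frechet_derivative g (at x) v" if "x \<in> S" for x
      using frechet_derivative_at[OF der[OF that]] by simp
  qed
  then show ?case using der by (auto simp: differentiable_def)
qed

text \<open>The way in which all closure properties below are proved: a formula for the derivative on the open set, and one order less of differentiability for that formula.\<close>

lemma Ck_on_SucI:
  assumes "open S" "\<And>x. x \<in> S \<Longrightarrow> (f has_derivative f' x) (at x)"
    and "\<And>v. Ck_on n (\<lambda>x. f' x v) S"
  shows "Ck_on (Suc n) f S"
proof -
  have "Ck_on n (\<lambda>x. frechet_derivative f (at x) v) S" for v
    by (rule Ck_on_cong[OF assms(1) _ assms(3)[of v]])
      (simp add: frechet_derivative_at[OF assms(2)])
  then show ?thesis using assms(2) by (auto simp: differentiable_def)
qed

lemma Ck_on_SucD: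
  assumes "Ck_on (Suc n) f S"
  shows "x \<in> S \<Longrightarrow> (f has_derivative frechet_derivative f (at x)) (at x)"
    and "Ck_on n (\<lambda>x. frechet_derivative f (at x) v) S"
  using assms by (auto simp: frechet_derivative_works)

lemma Ck_on_Suc_imp: "Ck_on (Suc n) f S \<Longrightarrow> Ck_on n f S"
proof (induction n arbitrary: f)
  case 0
  then show ?case
    by (auto intro!: differentiable_imp_continuous_on differentiable_at_imp_differentiable_on)
next
  case (Suc n)
  then show ?case by (metis Ck_on.simps(2))
qed

lemma Ck_on_const: "open S \<Longrightarrow> Ck_on n (\<lambda>x. c) S"
proof (induction n arbitrary: c)
  case (Suc n)
  show ?case
    by (rule Ck_on_SucI[OF Suc.prems, of _ "\<lambda>x v. 0"]) (auto intro: Suc)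
qed simp

lemma Ck_on_linear: "open S \<Longrightarrow> bounded_linear f \<Longrightarrow> Ck_on n f S"
proof (cases n)
  case 0
  assume "bounded_linear f"
  then show ?thesis using 0 by (simp add: linear_continuous_on)
next
  case (Suc m)
  assume "open S" "bounded_linear f"
  then show ?thesis unfolding Suc
    by (intro Ck_on_SucI[of _ _ "\<lambda>x. f"] Ck_on_const)
      (auto intro: bounded_linear_imp_has_derivative)
qed

lemma Ck_on_add:
  "open S \<Longrightarrow> Ck_on n f S \<Longrightarrow> Ck_on n g S \<Longrightarrow> Ck_on n (\<lambda>x. f x + g x) S"
proof (induction n arbitrary: f g)
  case (Suc n)
  show ?case
    by (rule Ck_on_SucI[OF Suc.prems(1)
          has_derivative_add[OF Ck_on_SucD(1)[OF Suc.prems(2)] Ck_on_SucD(1)[OF Suc.prems(3)]]])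
      (intro Suc.IH Suc.prems(1) Suc.prems(2,3)[THEN Ck_on_SucD(2)] | assumption)+
qed (simp add: continuous_intros)

lemma Ck_on_mult:
  fixes f g :: "'a::real_normed_vector \<Rightarrow> 'b::real_normed_algebra"
  shows "open S \<Longrightarrow> Ck_on n f S \<Longrightarrow> Ck_on n g S \<Longrightarrow> Ck_on n (\<lambda>x. f x * g x) S"
proof (induction n arbitrary: f g)
  case (Suc n)
  show ?case
    by (rule Ck_on_SucI[OF Suc.prems(1)
          has_derivative_mult[OF Ck_on_SucD(1)[OF Suc.prems(2)] Ck_on_SucD(1)[OF Suc.prems(3)]]])
      (intro Ck_on_add Suc.IH Suc.prems(1) Suc.prems(2,3)[THEN Ck_on_Suc_imp]
        Suc.prems(2,3)[THEN Ck_on_SucD(2)] | assumption)+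
qed (simp add: continuous_intros)

text \<open>The derivative is a product of inverses of \<open>f\<close> and the derivative of \<open>f\<close>, so the induction hypothesis and the product rule suffice.\<close>

lemma Ck_on_inverse:
  fixes f :: "'a::real_normed_vector \<Rightarrow> complex"
  shows "open S \<Longrightarrow> Ck_on n f S \<Longrightarrow> (\<And>x. x \<in> S \<Longrightarrow> f x \<noteq> 0) \<Longrightarrow> Ck_on n (\<lambda>x. inverse (f x)) S"
proof (induction n arbitrary: f)
  case (Suc n)
  have inv: "Ck_on n (\<lambda>x. inverse (f x)) S"
    using Suc Ck_on_Suc_imp by blast
  show ?case
  proof (rule Ck_on_SucI[OF Suc.prems(1)])
    show "((\<lambda>x. inverse (f x)) has_derivative
      (\<lambda>h. (-1) * (inverse (f x) * frechet_derivative f (at x) h * inverse (f x)))) (at x)"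
      if "x \<in> S" for x
      using Deriv.has_derivative_inverse[OF Suc.prems(3)[OF that] Ck_on_SucD(1)[OF Suc.prems(2) that]]
      by simp
    show "Ck_on n (\<lambda>x. (-1) * (inverse (f x) * frechet_derivative f (at x) v * inverse (f x))) S"
      for v
      using Suc.prems inv by (intro Ck_on_mult Ck_on_const Ck_on_SucD(2)[OF Suc.prems(2)])
  qed
qed (simp add: continuous_on_inverse)

lemma Ck_on_bounded_linear:
  "open S \<Longrightarrow> bounded_linear B \<Longrightarrow> Ck_on n f S \<Longrightarrow> Ck_on n (\<lambda>x. B (f x)) S"
proof (induction n arbitrary: f)
  case 0
  then show ?case by (auto intro: bounded_linear.continuous_on)
next
  case (Suc n)
  show ?case
    by (rule Ck_on_SucI[OF Suc.prems(1) bounded_linear.has_derivative[OF Suc.prems(2)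
          Ck_on_SucD(1)[OF Suc.prems(3)]]])
      (intro Suc.IH Suc.prems(1,2) Suc.prems(3)[THEN Ck_on_SucD(2)] | assumption)+
qed

lemma smooth_on_const: "open S \<Longrightarrow> smooth_on (\<lambda>x. c) S"
  by (simp add: smooth_on_def Ck_on_const)

lemma smooth_on_linear: "open S \<Longrightarrow> bounded_linear f \<Longrightarrow> smooth_on f S"
  by (simp add: smooth_on_def Ck_on_linear)

lemma smooth_on_add:
  "open S \<Longrightarrow> smooth_on f S \<Longrightarrow> smooth_on g S \<Longrightarrow> smooth_on (\<lambda>x. f x + g x) S"
  by (simp add: smooth_on_def Ck_on_add)

lemma smooth_on_mult:
  fixes f g :: "'a::real_normed_vector \<Rightarrow> 'b::real_normed_algebra"
  shows "open S \<Longrightarrow> smooth_on f S \<Longrightarrow> smooth_on g S \<Longrightarrow> smooth_on (\<lambda>x. f x * g x) S"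
  by (simp add: smooth_on_def Ck_on_mult)

lemma smooth_on_bounded_linear:
  "open S \<Longrightarrow> bounded_linear B \<Longrightarrow> smooth_on f S \<Longrightarrow> smooth_on (\<lambda>x. B (f x)) S"
  by (simp add: smooth_on_def Ck_on_bounded_linear)

lemma smooth_on_diff:
  fixes f g :: "'a::real_normed_vector \<Rightarrow> complex"
  assumes "open S" "smooth_on f S" "smooth_on g S"
  shows "smooth_on (\<lambda>x. f x - g x) S"
  using smooth_on_add[OF assms(1,2) smooth_on_mult[OF assms(1) smooth_on_const[of S "-1"] assms(3)]]
    assms(1) by simp

lemma smooth_on_divide:
  fixes f g :: "'a::real_normed_vector \<Rightarrow> complex"
  assumes "open S" "smooth_on f S" "smooth_on g S" "\<And>x. x \<in> S \<Longrightarrow> g x \<noteq> 0"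
  shows "smooth_on (\<lambda>x. f x / g x) S"
  using assms by (simp add: smooth_on_def divide_inverse Ck_on_mult Ck_on_inverse)

lemma smooth_on_sum:
  assumes "open S" "\<And>i. i \<in> I \<Longrightarrow> smooth_on (f i) S"
  shows "smooth_on (\<lambda>x. \<Sum>i\<in>I. f i x) S"
  using assms(2) by (induction I rule: infinite_finite_induct)
    (auto intro: smooth_on_const smooth_on_add assms(1))

lemma smooth_on_prod:
  fixes f :: "'i \<Rightarrow> 'a::real_normed_vector \<Rightarrow> complex"
  assumes "open S" "\<And>i. i \<in> I \<Longrightarrow> smooth_on (f i) S"
  shows "smooth_on (\<lambda>x. \<Prod>i\<in>I. f i x) S"
  using assms(2) by (induction I rule: infinite_finite_induct)
    (auto intro: smooth_on_const smooth_on_mult assms(1))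

lemma smooth_on_cnj: "open S \<Longrightarrow> smooth_on f S \<Longrightarrow> smooth_on (\<lambda>x. cnj (f x)) S"
  by (rule smooth_on_bounded_linear[OF _ bounded_linear_cnj])

lemma smooth_on_power:
  fixes f :: "'a::real_normed_vector \<Rightarrow> complex"
  shows "open S \<Longrightarrow> smooth_on f S \<Longrightarrow> smooth_on (\<lambda>x. f x ^ n) S"
  by (induction n) (auto intro: smooth_on_const smooth_on_mult)

lemma smooth_on_vec:
  fixes f :: "'n::finite \<Rightarrow> 'a::real_normed_vector \<Rightarrow> complex"
  assumes "open S" "\<And>j. smooth_on (f j) S"
  shows "smooth_on (\<lambda>x. \<chi> j. f j x) S"
proof -
  have lin: "bounded_linear (\<lambda>c::complex. axis j c :: complex^'n)" for j
    by (intro linear_conv_bounded_linear[THEN iffD1] linearI) (auto simp: axis_def vec_eq_iff)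
  have "(\<lambda>x. \<chi> j. f j x) = (\<lambda>x. \<Sum>j\<in>UNIV. axis j (f j x))"
    by (auto simp: vec_eq_iff axis_def)
  then show ?thesis
    using smooth_on_sum[OF assms(1) smooth_on_bounded_linear[OF assms(1) lin assms(2)]] by simp
qed

lemma smooth_on_imp_continuous_on: "smooth_on f S \<Longrightarrow> continuous_on S f"
  unfolding smooth_on_def by (metis Ck_on.simps(1))

section \<open>Exterior products of one-forms\<close>

text \<open>The determinant expression for \<open>t\<^sub>0 \<and> \<dots> \<and> t\<^sub>n\<^sub>-\<^sub>1\<close>, with the one-forms taken as functions of a single vector. It makes the exterior algebra of decomposable forms a matter of reordering lists.\<close>

definition wedge_list :: "('e \<Rightarrow> complex) list \<Rightarrow> 'e cform" where
  "wedge_list ts = (\<lambda>v. \<Sum>\<sigma> | \<sigma> permutes {..<length ts}.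
     of_int (sign \<sigma>) * (\<Prod>i<length ts. (ts ! i) (v (\<sigma> i))))"

lemma finite_permutes_lessThan: "finite {\<sigma>. \<sigma> permutes {..<n::nat}}"
  by (simp add: finite_permutations)

lemma prod_lessThan_add:
  "(\<Prod>i<p+q. f i) = (\<Prod>i<p. f i) * (\<Prod>j<q. f (p + j))"
  for f :: "nat \<Rightarrow> 'a::comm_monoid_mult"
  by (induction q) (simp_all add: mult_ac)

text \<open>The sum of two permutations, one acting on the first \<open>p\<close> places and the other on the last \<open>q\<close>.\<close>

lemma block_permutation:
  assumes "\<tau> permutes {..<p}" "\<rho> permutes {..<q}"
  obtains \<beta> where "\<beta> permutes {..<p+q::nat}" "sign \<beta> = sign \<tau> * sign \<rho>"
    "\<And>i. i < p \<Longrightarrow> \<beta> i = \<tau> i" "\<And>j. j < q \<Longrightarrow> \<beta> (p + j) = p + \<rho> j"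
proof
  define \<rho>' where "\<rho>' = map_permutation {..<q} (\<lambda>j. p + j) \<rho>"
  have inj: "inj_on (\<lambda>j. p + j) {..<q}" by simp
  have "bij_betw (\<lambda>j. p + j) {..<q} {p..<p+q}"
    by (simp add: bij_betw_def lessThan_atLeast0 add.commute)
  then have \<rho>': "\<rho>' permutes {p..<p+q}"
    unfolding \<rho>'_def using assms(2) by (rule map_permutation_permutes)
  have "\<rho>' permutes {..<p+q}" "\<tau> permutes {..<p+q}"
    by (auto intro: permutes_subset[OF \<rho>'] permutes_subset[OF assms(1)])
  then show "\<tau> \<circ> \<rho>' permutes {..<p+q}"
    by (rule permutes_compose)
  have "permutation \<tau>" "permutation \<rho>'"
    using assms(1) \<rho>' permutation_permutes by blast+
  then show "sign (\<tau> \<circ> \<rho>') = sign \<tau> * sign \<rho>"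
    using sign_map_permutation[OF inj assms(2)]
    by (simp add: sign_compose \<rho>'_def)
  show "(\<tau> \<circ> \<rho>') i = \<tau> i" if "i < p" for i
    using permutes_not_in[OF \<rho>', of i] that by simp
  show "(\<tau> \<circ> \<rho>') (p + j) = p + \<rho> j" if "j < q" for j
  proof -
    have "\<rho>' (p + j) = p + \<rho> j"
      unfolding \<rho>'_def using that inj by (simp add: map_permutation_apply)
    then show ?thesis using permutes_not_in[OF assms(1)] by simp
  qed
qed

text \<open>Associativity of the exterior product, in the only form needed. Expanding both factors gives a sum over \<open>\<sigma>\<close> in \<open>S(p+q)\<close>, \<open>\<tau>\<close> in \<open>S(p)\<close> and \<open>\<rho>\<close> in \<open>S(q)\<close>. For fixed \<open>\<tau>\<close> and \<open>\<rho>\<close> the substitution of \<open>\<sigma>\<close> by \<open>\<sigma>\<close> composed with the block permutation shows that the sum over \<open>\<sigma>\<close> does not depend on them, and the \<open>p! q!\<close> pairs cancel the normalising factor of the wedge product.\<close>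

lemma wedge_wedge_list:
  "wedge (length s) (length t) (wedge_list s) (wedge_list t) = wedge_list (s @ t)"
proof
  fix v
  let ?p = "length s" and ?q = "length t"
  let ?P = "\<lambda>n. {\<sigma>. \<sigma> permutes {..<n::nat}}"
  define F where "F \<sigma> = of_int (sign \<sigma>) * (\<Prod>i<?p+?q. ((s @ t) ! i) (v (\<sigma> i)))" for \<sigma>
  have F: "sum F (?P (?p+?q)) = wedge_list (s @ t) v"
    by (simp add: wedge_list_def F_def)
  \<comment> \<open>for fixed permutations of the two blocks, reindexing absorbs them into the outer sum\<close>
  have inner: "(\<Sum>\<sigma>\<in>?P (?p+?q). of_int (sign \<sigma>) *
        (of_int (sign \<tau>) * (\<Prod>i<?p. (s ! i) (v (\<sigma> (\<tau> i))))) *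
        (of_int (sign \<rho>) * (\<Prod>j<?q. (t ! j) (v (\<sigma> (?p + \<rho> j)))))) = sum F (?P (?p+?q))"
    if \<tau>: "\<tau> \<in> ?P ?p" and \<rho>: "\<rho> \<in> ?P ?q" for \<tau> \<rho>
  proof -
    from \<tau> \<rho> have "\<tau> permutes {..<?p}" "\<rho> permutes {..<?q}" by simp_all
    then obtain \<beta> where \<beta>: "\<beta> permutes {..<?p+?q}" "sign \<beta> = sign \<tau> * sign \<rho>"
      "\<And>i. i < ?p \<Longrightarrow> \<beta> i = \<tau> i" "\<And>j. j < ?q \<Longrightarrow> \<beta> (?p + j) = ?p + \<rho> j"
      by (rule block_permutation) blast
    have "F (\<sigma> \<circ> \<beta>) = of_int (sign \<sigma>) *
        (of_int (sign \<tau>) * (\<Prod>i<?p. (s ! i) (v (\<sigma> (\<tau> i))))) *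
        (of_int (sign \<rho>) * (\<Prod>j<?q. (t ! j) (v (\<sigma> (?p + \<rho> j)))))"
      if "\<sigma> \<in> ?P (?p+?q)" for \<sigma>
    proof -
      have "permutation \<sigma>" "permutation \<beta>"
        using that \<beta>(1) permutation_permutes by blast+
      then have "sign (\<sigma> \<circ> \<beta>) = sign \<sigma> * (sign \<tau> * sign \<rho>)"
        by (simp add: sign_compose \<beta>(2))
      then show ?thesis
        unfolding F_def prod_lessThan_add
        by (simp add: nth_append \<beta>(3,4) mult_ac)
    qed
    then show ?thesis
      by (subst sum_permutations_compose_right[OF \<beta>(1), of F]) (auto intro!: sum.cong)
  qed
  have "(\<Sum>\<sigma>\<in>?P (?p+?q). of_int (sign \<sigma>) * wedge_list s (\<lambda>i. v (\<sigma> i)) *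
          wedge_list t (\<lambda>i. v (\<sigma> (?p + i)))) =
        (\<Sum>\<sigma>\<in>?P (?p+?q). \<Sum>\<tau>\<in>?P ?p. \<Sum>\<rho>\<in>?P ?q. of_int (sign \<sigma>) *
          (of_int (sign \<tau>) * (\<Prod>i<?p. (s ! i) (v (\<sigma> (\<tau> i))))) *
          (of_int (sign \<rho>) * (\<Prod>j<?q. (t ! j) (v (\<sigma> (?p + \<rho> j))))))"
    unfolding wedge_list_def sum_distrib_left sum_distrib_right
    by (rule sum.cong[OF refl], rule sum.swap)
  also have "\<dots> = (\<Sum>\<tau>\<in>?P ?p. \<Sum>\<rho>\<in>?P ?q. \<Sum>\<sigma>\<in>?P (?p+?q). of_int (sign \<sigma>) *
          (of_int (sign \<tau>) * (\<Prod>i<?p. (s ! i) (v (\<sigma> (\<tau> i))))) *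
          (of_int (sign \<rho>) * (\<Prod>j<?q. (t ! j) (v (\<sigma> (?p + \<rho> j))))))"
    by (subst sum.swap, rule sum.cong[OF refl], rule sum.swap)
  also have "\<dots> = (\<Sum>\<tau>\<in>?P ?p. \<Sum>\<rho>\<in>?P ?q. wedge_list (s @ t) v)"
    by (intro sum.cong refl) (simp only: inner F)
  also have "\<dots> = fact ?p * fact ?q * wedge_list (s @ t) v"
    by (simp add: card_permutations)
  finally show "wedge ?p ?q (wedge_list s) (wedge_list t) v = wedge_list (s @ t) v"
    by (simp add: wedge_def)
qed

text \<open>Permuting the one-forms amounts to permuting the vectors by the inverse, which reindexes the sum at the cost of a sign.\<close>

lemma wedge_list_permute:
  assumes "\<pi> permutes {..<length ts}"
  shows "wedge_list (permute_list \<pi> ts) v = of_int (sign \<pi>) * wedge_list ts v"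
proof -
  let ?n = "length ts"
  have \<pi>: "permutation \<pi>" using assms permutation_permutes by blast
  have "wedge_list ts v = (\<Sum>\<sigma> | \<sigma> permutes {..<?n}.
      of_int (sign (\<sigma> \<circ> inv \<pi>)) * (\<Prod>i<?n. (ts ! i) (v ((\<sigma> \<circ> inv \<pi>) i))))"
    unfolding wedge_list_def by (rule sum_permutations_compose_right[OF permutes_inv[OF assms]])
  also have "\<dots> = (\<Sum>\<sigma> | \<sigma> permutes {..<?n}. of_int (sign \<pi>) *
      (of_int (sign \<sigma>) * (\<Prod>i<?n. (ts ! \<pi> i) (v (\<sigma> i)))))"
  proof (rule sum.cong[OF refl])
    fix \<sigma> assume "\<sigma> \<in> {\<sigma>. \<sigma> permutes {..<?n}}"
    then have "permutation \<sigma>" using permutation_permutes by blast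
    then have "sign (\<sigma> \<circ> inv \<pi>) = sign \<pi> * sign \<sigma>"
      using \<pi> by (simp add: sign_compose sign_inverse permutation_inverse)
    moreover have "(\<Prod>i<?n. (ts ! i) (v ((\<sigma> \<circ> inv \<pi>) i))) = (\<Prod>i<?n. (ts ! \<pi> i) (v (\<sigma> i)))"
      by (subst prod.permute[OF assms]) (simp add: permutes_inverses[OF assms])
    ultimately show "of_int (sign (\<sigma> \<circ> inv \<pi>)) * (\<Prod>i<?n. (ts ! i) (v ((\<sigma> \<circ> inv \<pi>) i))) =
      of_int (sign \<pi>) * (of_int (sign \<sigma>) * (\<Prod>i<?n. (ts ! \<pi> i) (v (\<sigma> i))))"
      by (simp only: of_int_mult mult.assoc)
  qed
  also have "\<dots> = of_int (sign \<pi>) * wedge_list (permute_list \<pi> ts) v"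
    using assms by (simp add: wedge_list_def sum_distrib_left permute_list_nth)
  finally show ?thesis
    by (simp flip: mult.assoc of_int_mult)
qed

lemma wedge_list_transpose:
  assumes "i < length ts" "j < length ts" "i \<noteq> j"
  shows "wedge_list (ts[i := ts ! j, j := ts ! i]) = (\<lambda>v. - wedge_list ts v)"
proof
  fix v
  have p: "Transposition.transpose i j permutes {..<length ts}"
    using assms by (intro permutes_swap_id) auto
  have "permute_list (Transposition.transpose i j) ts = ts[i := ts ! j, j := ts ! i]"
    using assms p
    by (intro nth_equalityI)
      (auto simp: permute_list_nth nth_list_update Transposition.transpose_def)
  then show "wedge_list (ts[i := ts ! j, j := ts ! i]) v = - wedge_list ts v"
    using wedge_list_permute[OF p, of v] assms(3) by (simp add: sign_swap_id)
qed

lemma wedge_list_swap: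
  "wedge_list (xs @ b # a # ys) = (\<lambda>v. - wedge_list (xs @ a # b # ys) v)"
  using wedge_list_transpose[of "length xs" "xs @ a # b # ys" "Suc (length xs)"]
  by (simp add: nth_append list_update_append)

lemma wedge_list_not_distinct: "\<not> distinct ts \<Longrightarrow> wedge_list ts = (\<lambda>v. 0)"
proof -
  assume "\<not> distinct ts"
  then obtain i j where ij: "i < length ts" "j < length ts" "i \<noteq> j" "ts ! i = ts ! j"
    by (auto simp: distinct_conv_nth)
  then have "ts[i := ts ! j, j := ts ! i] = ts"
    by (metis list_update_id)
  then show ?thesis
    using wedge_list_transpose[OF ij(1-3)] by (auto simp: fun_eq_iff)
qed

text \<open>Linearity in a slot holds summand by summand, since exactly one factor sees that slot. For repeated vectors, composing \<open>\<sigma>\<close> with the transposition of the two slots changes every sign and nothing else.\<close>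

lemma alternating_wedge_list:
  assumes "\<And>t. t \<in> set ts \<Longrightarrow> linear t"
  shows "alternating (length ts) (wedge_list ts)"
  unfolding alternating_def
proof (intro conjI allI impI)
  let ?n = "length ts"
  fix v w :: "nat \<Rightarrow> 'a" assume vw: "\<forall>i<?n. v i = w i"
  have "v (\<sigma> i) = w (\<sigma> i)" if "\<sigma> permutes {..<?n}" "i < ?n" for \<sigma> i
    using vw permutes_in_image[OF that(1), of i] that(2) by auto
  then show "wedge_list ts v = wedge_list ts w"
    unfolding wedge_list_def by (intro sum.cong refl arg_cong2[of _ _ _ _ "(*)"] prod.cong) auto
next
  let ?n = "length ts"
  fix v :: "nat \<Rightarrow> 'a" and i assume i: "i < ?n"
  have "linear (\<lambda>x. of_int (sign \<sigma>) * (\<Prod>k<?n. (ts ! k) ((v(i := x)) (\<sigma> k))))"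
    if \<sigma>: "\<sigma> \<in> {\<sigma>. \<sigma> permutes {..<?n}}" for \<sigma>
  proof -
    \<comment> \<open>the one factor that receives the i-th vector\<close>
    define j where "j = inv \<sigma> i"
    have perm: "\<sigma> permutes {..<?n}" using \<sigma> by simp
    have j: "j < ?n" "\<sigma> j = i"
      using permutes_in_image[OF permutes_inv[OF perm], of i] i permutes_inverses[OF perm]
      by (auto simp: j_def)
    have other: "\<sigma> k \<noteq> i" if "k \<noteq> j" for k
      using that j(2) permutes_inj[OF perm] by (auto dest: injD)
    have "(\<lambda>x. of_int (sign \<sigma>) * (\<Prod>k<?n. (ts ! k) ((v(i := x)) (\<sigma> k)))) =
       (\<lambda>x. (of_int (sign \<sigma>) * (\<Prod>k\<in>{..<?n}-{j}. (ts ! k) (v (\<sigma> k)))) * (ts ! j) x)"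
      using j other by (auto simp: fun_eq_iff prod.remove[of "{..<?n}" j] mult_ac
          intro!: prod.cong)
    moreover have "linear (ts ! j)" using assms j(1) by auto
    ultimately show ?thesis
      by (simp add: linear_iff algebra_simps)
  qed
  then show "linear (\<lambda>x. wedge_list ts (v(i := x)))"
    unfolding wedge_list_def by (intro linear_compose_sum) auto
next
  let ?n = "length ts"
  fix v :: "nat \<Rightarrow> 'a" and i j
  assume ij: "i < ?n \<and> j < ?n \<and> i \<noteq> j \<and> v i = v j"
  define q where "q = Transposition.transpose i j"
  have q: "q permutes {..<?n}" "permutation q" "sign q = -1"
    using ij by (auto simp: q_def intro: permutes_swap_id permutation_swap_id
        simp: sign_swap_id)
  have vq: "v (q k) = v k" for k
    using ij by (simp add: q_def Transposition.transpose_def)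
  have "wedge_list ts v = (\<Sum>\<sigma> | \<sigma> permutes {..<?n}.
      of_int (sign (q \<circ> \<sigma>)) * (\<Prod>k<?n. (ts ! k) (v ((q \<circ> \<sigma>) k))))"
    unfolding wedge_list_def by (rule setum_permutations_compose_left[OF q(1)])
  also have "\<dots> = (\<Sum>\<sigma> | \<sigma> permutes {..<?n}. -
      (of_int (sign \<sigma>) * (\<Prod>k<?n. (ts ! k) (v (\<sigma> k)))))"
  proof (rule sum.cong[OF refl])
    fix \<sigma> assume "\<sigma> \<in> {\<sigma>. \<sigma> permutes {..<?n}}"
    then have "permutation \<sigma>" using permutation_permutes by blast
    then have "sign (q \<circ> \<sigma>) = - sign \<sigma>" using q by (simp add: sign_compose)
    then show "of_int (sign (q \<circ> \<sigma>)) * (\<Prod>k<?n. (ts ! k) (v ((q \<circ> \<sigma>) k))) =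
       - (of_int (sign \<sigma>) * (\<Prod>k<?n. (ts ! k) (v (\<sigma> k))))"
      by (simp add: vq)
  qed
  also have "\<dots> = - wedge_list ts v"
    by (simp add: wedge_list_def sum_negf)
  finally show "wedge_list ts v = 0" by simp
qed

lemma wedge_list_Nil: "wedge_list [] = (\<lambda>v. 1)"
  by (simp add: wedge_list_def)

lemma wedge_list_single: "wedge_list [t] = (\<lambda>v. t (v 0))"
  by (simp add: wedge_list_def lessThan_Suc)

lemma wedge_list_two: "wedge_list [s, t] v = s (v 0) * t (v 1) - s (v 1) * t (v 0)"
proof -
  have "{..<length [s, t]} = {0, 1}" by auto
  moreover have "id \<noteq> Transposition.transpose 0 (1::nat)"
    by (metis id_apply transpose_apply_first zero_neq_one)
  then have "sum f {\<sigma>. \<sigma> permutes {0, 1::nat}} = f id + f (Transposition.transpose 0 1)"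
    for f :: "_ \<Rightarrow> complex"
    by (subst permutes_doubleton_iff) (simp add: Collect_disj_eq)
  ultimately show ?thesis
    by (simp add: wedge_list_def sign_swap_id Transposition.transpose_def)
qed

lemma wedge_list_dual_basis:
  assumes "\<And>i j. i < length ts \<Longrightarrow> j < length ts \<Longrightarrow> (ts ! i) (v j) = (if i = j then 1 else 0)"
  shows "wedge_list ts v = 1"
proof -
  let ?n = "length ts"
  have "of_int (sign \<sigma>) * (\<Prod>i<?n. (ts ! i) (v (\<sigma> i))) = (if \<sigma> = id then 1 else 0)"
    if "\<sigma> permutes {..<?n}" for \<sigma>
  proof (cases "\<sigma> = id")
    case False
    then obtain i where "\<sigma> i \<noteq> i" by (auto simp: fun_eq_iff)
    moreover from this have "i < ?n" using permutes_not_in[OF that, of i] by auto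
    moreover have "\<sigma> i < ?n" using permutes_in_image[OF that, of i] \<open>i < ?n\<close> by auto
    ultimately have "(ts ! i) (v (\<sigma> i)) = 0" using assms by auto
    then show ?thesis using False \<open>i < ?n\<close> by auto
  qed (simp add: assms)
  then have "wedge_list ts v = (\<Sum>\<sigma> | \<sigma> permutes {..<?n}. if \<sigma> = id then 1 else 0)"
    unfolding wedge_list_def by (intro sum.cong) auto
  also have "\<dots> = 1" by (simp add: finite_permutes_lessThan)
  finally show ?thesis .
qed

lemma wedge_list_cnj: "conj_form (wedge_list ts) = wedge_list (map (\<lambda>t u. cnj (t u)) ts)"
  by (auto simp: conj_form_def wedge_list_def fun_eq_iff intro!: sum.cong prod.cong)

lemma wedge_list_pull: "pull_form D (wedge_list ts) = wedge_list (map (\<lambda>t u. t (D u)) ts)"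
  by (auto simp: pull_form_def wedge_list_def fun_eq_iff intro!: sum.cong prod.cong)

lemma wedge_one_forms_eq_wedge_list:
  "wedge_one_forms n (\<lambda>i v. t i (v 0)) = wedge_list (map t [0..<n])"
proof (induction n)
  case (Suc n)
  have "wedge n 1 (wedge_list (map t [0..<n])) (wedge_list [t n]) = wedge_list (map t [0..<Suc n])"
    using wedge_wedge_list[of "map t [0..<n]" "[t n]"] by simp
  then show ?case using Suc by (simp add: wedge_list_single)
qed (simp add: wedge_list_Nil)

lemma wedge_pull: "pull_form D (wedge p q \<eta> \<theta>) = wedge p q (pull_form D \<eta>) (pull_form D \<theta>)"
  by (simp add: pull_form_def wedge_def)

lemma wedge_scale_left: "wedge p q (\<lambda>v. c * \<eta> v) \<theta> = (\<lambda>v. c * wedge p q \<eta> \<theta> v)"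
  by (simp add: wedge_def sum_distrib_left mult_ac fun_eq_iff)

lemma wedge_scale_right: "wedge p q \<eta> (\<lambda>v. c * \<theta> v) = (\<lambda>v. c * wedge p q \<eta> \<theta> v)"
  by (simp add: wedge_def sum_distrib_left mult_ac fun_eq_iff)

lemma wedge_add_left:
  "wedge p q (\<lambda>v. \<eta> v + \<eta>' v) \<theta> = (\<lambda>v. wedge p q \<eta> \<theta> v + wedge p q \<eta>' \<theta> v)"
  by (simp add: wedge_def algebra_simps sum.distrib add_divide_distrib fun_eq_iff)

lemma wedge_add_right:
  "wedge p q \<eta> (\<lambda>v. \<theta> v + \<theta>' v) = (\<lambda>v. wedge p q \<eta> \<theta> v + wedge p q \<eta> \<theta>' v)"
  by (simp add: wedge_def algebra_simps sum.distrib add_divide_distrib fun_eq_iff)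

section \<open>Alternating forms\<close>

lemma linear_cmult: "linear t \<Longrightarrow> linear (\<lambda>u. (c::complex) * t u)"
  by (simp add: linear_iff algebra_simps)

lemma alternatingI:
  assumes "\<And>v w. (\<And>i. i < k \<Longrightarrow> v i = w i) \<Longrightarrow> \<eta> v = \<eta> w"
    and "\<And>v i. i < k \<Longrightarrow> linear (\<lambda>x. \<eta> (v(i := x)))"
    and "\<And>v i j. i < k \<Longrightarrow> j < k \<Longrightarrow> i \<noteq> j \<Longrightarrow> v i = v j \<Longrightarrow> \<eta> v = 0"
  shows "alternating k \<eta>"
  unfolding alternating_def
proof (intro conjI allI impI)
  fix v w :: "nat \<Rightarrow> 'a" assume "\<forall>i<k. v i = w i"
  then show "\<eta> v = \<eta> w" by (intro assms(1)) simp
next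
  fix v :: "nat \<Rightarrow> 'a" and i j assume "i < k \<and> j < k \<and> i \<noteq> j \<and> v i = v j"
  then show "\<eta> v = 0" using assms(3)[of i j v] by simp
qed (rule assms(2))

lemma alternatingD:
  assumes "alternating k \<eta>"
  shows "(\<And>i. i < k \<Longrightarrow> v i = w i) \<Longrightarrow> \<eta> v = \<eta> w"
    and "i < k \<Longrightarrow> linear (\<lambda>x. \<eta> (v(i := x)))"
    and "i < k \<Longrightarrow> j < k \<Longrightarrow> i \<noteq> j \<Longrightarrow> v i = v j \<Longrightarrow> \<eta> v = 0"
proof -
  show "\<eta> v = \<eta> w" if "\<And>i. i < k \<Longrightarrow> v i = w i"
    using assms that unfolding alternating_def by meson
  show "linear (\<lambda>x. \<eta> (v(i := x)))" if "i < k"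
    using assms that unfolding alternating_def by simp
  show "\<eta> v = 0" if "i < k" "j < k" "i \<noteq> j" "v i = v j"
    using assms that unfolding alternating_def by meson
qed

lemma alternating_cmult:
  assumes "alternating k \<eta>"
  shows "alternating k (\<lambda>v. c * \<eta> v)"
proof (rule alternatingI)
  show "c * \<eta> v = c * \<eta> w" if "\<And>i. i < k \<Longrightarrow> v i = w i" for v w
    using alternatingD(1)[OF assms that] by simp
  show "c * \<eta> v = 0" if "i < k" "j < k" "i \<noteq> j" "v i = v j" for v i j
    using alternatingD(3)[where v = v, OF assms that] by simp
qed (intro linear_cmult alternatingD(2)[OF assms])

lemma alternating_diff:
  assumes "alternating k \<eta>" "alternating k \<theta>"
  shows "alternating k (\<lambda>v. \<eta> v - \<theta> v)"
proof (rule alternatingI)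
  show "\<eta> v - \<theta> v = \<eta> w - \<theta> w" if "\<And>i. i < k \<Longrightarrow> v i = w i" for v w
    using alternatingD(1)[OF assms(1) that] alternatingD(1)[OF assms(2) that] by simp
  show "\<eta> v - \<theta> v = 0" if "i < k" "j < k" "i \<noteq> j" "v i = v j" for v i j
    using alternatingD(3)[where v = v, OF assms(1) that]
      alternatingD(3)[where v = v, OF assms(2) that] by simp
qed (intro linear_compose_sub alternatingD(2)[OF assms(1)] alternatingD(2)[OF assms(2)])

lemma alternating_sum:
  fixes \<eta> :: "'i \<Rightarrow> 'e::real_vector cform"
  assumes "\<And>a. a \<in> I \<Longrightarrow> alternating k (\<eta> a)"
  shows "alternating k (\<lambda>v. \<Sum>a\<in>I. \<eta> a v)"
proof (rule alternatingI)
  show "(\<Sum>a\<in>I. \<eta> a v) = (\<Sum>a\<in>I. \<eta> a w)" if "\<And>i. i < k \<Longrightarrow> v i = w i" for v w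
    using alternatingD(1)[OF assms that] by (intro sum.cong refl)
  show "(\<Sum>a\<in>I. \<eta> a v) = 0" if "i < k" "j < k" "i \<noteq> j" "v i = v j" for v i j
    using alternatingD(3)[where v = v, OF assms that] by (intro sum.neutral ballI)
  show "linear (\<lambda>x. \<Sum>a\<in>I. \<eta> a (v(i := x)))" if "i < k" for v i
    using alternatingD(2)[OF assms that] by (intro linear_compose_sum ballI)
qed

lemma alternating_pull:
  assumes "linear L" "alternating k \<eta>"
  shows "alternating k (pull_form L \<eta>)"
proof (rule alternatingI)
  show "pull_form L \<eta> v = pull_form L \<eta> w" if "\<And>i. i < k \<Longrightarrow> v i = w i" for v w
    unfolding pull_form_def by (rule alternatingD(1)[OF assms(2)]) (simp add: that)
  show "pull_form L \<eta> v = 0" if "i < k" "j < k" "i \<noteq> j" "v i = v j" for v i j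
    unfolding pull_form_def by (rule alternatingD(3)[OF assms(2) that(1-3)]) (simp add: that)
  show "linear (\<lambda>x. pull_form L \<eta> (v(i := x)))" if "i < k" for v i
  proof -
    have "linear (\<lambda>x. \<eta> ((\<lambda>j. L (v j))(i := L x)))"
      using linear_compose[OF assms(1) alternatingD(2)[OF assms(2) that, of "\<lambda>j. L (v j)"]]
      by (simp add: o_def)
    moreover have "(\<lambda>j. L ((v(i := x)) j)) = (\<lambda>j. L (v j))(i := L x)" for x by auto
    ultimately show ?thesis by (simp add: pull_form_def)
  qed
qed

section \<open>The algebraic SU(3) conditions\<close>

definition cnj_map :: "('e \<Rightarrow> complex) \<Rightarrow> 'e \<Rightarrow> complex" where
  "cnj_map t = (\<lambda>u. cnj (t u))"

text \<open>The two-form of which the given one-forms are a unitary coframe.\<close>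

definition fundamental_form :: "('e \<Rightarrow> complex) list \<Rightarrow> 'e cform" where
  "fundamental_form ts = (\<lambda>v. \<i> / 2 * (\<Sum>t\<leftarrow>ts. wedge_list [t, cnj_map t] v))"

lemma fundamental_form_eq: "fundamental_form ts v = (\<Sum>t\<leftarrow>ts. \<i> / 2 * (t (v 0) * cnj (t (v 1)) - t (v 1) * cnj (t (v 0))))"
  unfolding fundamental_form_def wedge_list_two cnj_map_def
  by (induction ts) (simp_all add: algebra_simps)

lemma fundamental_form_real: "fundamental_form ts v \<in> \<real>"
proof -
  have "Im (fundamental_form ts v) = 0"
    unfolding fundamental_form_eq by (induction ts) (simp_all add: algebra_simps)
  then show ?thesis by (simp add: complex_is_Real_iff)
qed

text \<open>Evaluation on a vector and its image under the almost complex structure for which all the one-forms are of type (1,0); this is the source of nondegeneracy.\<close>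

lemma fundamental_form_rotated:
  assumes "\<And>t. t \<in> set ts \<Longrightarrow> t (v 1) = \<i> * t (v 0)"
  shows "fundamental_form ts v = of_real (\<Sum>t\<leftarrow>ts. (cmod (t (v 0)))\<^sup>2)"
  using assms unfolding fundamental_form_eq
proof (induction ts)
  case (Cons t ts)
  have t: "t (v 1) = \<i> * t (v 0)" by (rule Cons.prems) simp
  have "\<i> / 2 * (t (v 0) * cnj (t (v 1)) - t (v 1) * cnj (t (v 0))) =
      of_real ((cmod (t (v 0)))\<^sup>2)"
    unfolding t by (simp add: complex_norm_square del: of_real_power)
  moreover have "(\<Sum>t\<leftarrow>ts. \<i> / 2 * (t (v 0) * cnj (t (v 1)) - t (v 1) * cnj (t (v 0)))) =
      of_real (\<Sum>t\<leftarrow>ts. (cmod (t (v 0)))\<^sup>2)"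
    by (rule Cons.IH) (rule Cons.prems, simp)
  ultimately show ?case by (simp only: list.map sum_list.Cons of_real_add)
qed simp

text \<open>Two-forms commute.\<close>

lemma wedge_list_swap_pairs:
  "wedge_list (xs @ c # d # a # b # ys) = wedge_list (xs @ a # b # c # d # ys)"
proof -
  have "wedge_list (xs @ c # d # a # b # ys) = (\<lambda>v. - wedge_list (xs @ c # a # d # b # ys) v)"
    using wedge_list_swap[of "xs @ [c]" d a "b # ys"] by simp
  also have "\<dots> = wedge_list (xs @ a # c # d # b # ys)"
    using wedge_list_swap[of xs c a "d # b # ys"] by simp
  also have "\<dots> = (\<lambda>v. - wedge_list (xs @ a # c # b # d # ys) v)"
    using wedge_list_swap[of "xs @ [a, c]" d b ys] by simp
  also have "\<dots> = wedge_list (xs @ a # b # c # d # ys)"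
    using wedge_list_swap[of "xs @ [a]" c b "d # ys"] by simp
  finally show ?thesis .
qed

text \<open>Sorting takes three adjacent transpositions, whence the sign \<open>(-1)\<^bsup>m(m-1)/2\<^esup>\<close> with \<open>m = 3\<close>.\<close>

lemma wedge_list_unshuffle:
  "wedge_list [a, b, c, a', b', c'] = (\<lambda>v. - wedge_list [a, a', b, b', c, c'] v)"
proof -
  have "wedge_list [a, b, c, a', b', c'] = (\<lambda>v. - wedge_list [a, b, a', c, b', c'] v)"
    using wedge_list_swap[of "[a, b]" c a' "[b', c']"] by simp
  also have "\<dots> = wedge_list [a, a', b, c, b', c']"
    using wedge_list_swap[of "[a]" b a' "[c, b', c']"] by simp
  also have "\<dots> = (\<lambda>v. - wedge_list [a, a', b, b', c, c'] v)"
    using wedge_list_swap[of "[a, a', b]" c b' "[c']"] by simp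
  finally show ?thesis .
qed

text \<open>Of the 27 products in the expansion only the 6 without repeated indices survive, and they are equal because two-forms commute. The coefficient is \<open>6 (i/2)\<^sup>3\<close>.\<close>

lemma fundamental_form_cubed:
  "two_form_power 3 (fundamental_form [t0, t1, t2]) =
   (\<lambda>v. - (3 * \<i> / 4) * wedge_list [t0, cnj_map t0, t1, cnj_map t1, t2, cnj_map t2] v)"
proof -
  let ?W = "wedge_list [t0, cnj_map t0, t1, cnj_map t1, t2, cnj_map t2]"
  have form: "fundamental_form [t0, t1, t2] = (\<lambda>v. (\<i>/2) * (wedge_list [t0, cnj_map t0] v +
     (wedge_list [t1, cnj_map t1] v + wedge_list [t2, cnj_map t2] v)))"
    by (simp add: fundamental_form_def fun_eq_iff)
  have w0: "wedge 0 2 (\<lambda>v. 1) (wedge_list [a, b]) = wedge_list [a, b]" for a b :: "'a \<Rightarrow> complex"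
    using wedge_wedge_list[of "[]" "[a, b]"] by (simp add: wedge_list_Nil numeral_2_eq_2)
  have w2: "wedge 2 2 (wedge_list [a, b]) (wedge_list [c, d]) = wedge_list [a, b, c, d]"
    for a b c d :: "'a \<Rightarrow> complex"
    using wedge_wedge_list[of "[a, b]" "[c, d]"] by (simp add: numeral_2_eq_2)
  have w4: "wedge 4 2 (wedge_list [a, b, c, d]) (wedge_list [e, f]) = wedge_list [a, b, c, d, e, f]"
    for a b c d e f :: "'a \<Rightarrow> complex"
    using wedge_wedge_list[of "[a, b, c, d]" "[e, f]"] by (simp add: eval_nat_numeral)
  have null: "wedge_list [a, a', a, a', c, c'] v = 0" "wedge_list [a, a', c, c', a, a'] v = 0"
    "wedge_list [c, c', a, a', a, a'] v = 0"
    for a a' c c' :: "'a \<Rightarrow> complex" and v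
    by (subst wedge_list_not_distinct; simp)+
  have sw: "wedge_list [b, b', a, a', c, c'] v = wedge_list [a, a', b, b', c, c'] v"
    "wedge_list [a, a', c, c', b, b'] v = wedge_list [a, a', b, b', c, c'] v"
    for a a' b b' c c' :: "'a \<Rightarrow> complex" and v
    using wedge_list_swap_pairs[of "[]" b b' a a' "[c, c']"]
      wedge_list_swap_pairs[of "[a, a']" c c' b b' "[]"] by simp_all
  have orders:
    "wedge_list [t0, cnj_map t0, t2, cnj_map t2, t1, cnj_map t1] v = ?W v"
    "wedge_list [t1, cnj_map t1, t0, cnj_map t0, t2, cnj_map t2] v = ?W v"
    "wedge_list [t1, cnj_map t1, t2, cnj_map t2, t0, cnj_map t0] v = ?W v"
    "wedge_list [t2, cnj_map t2, t0, cnj_map t0, t1, cnj_map t1] v = ?W v"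
    "wedge_list [t2, cnj_map t2, t1, cnj_map t1, t0, cnj_map t0] v = ?W v" for v
    by (metis sw)+
  have p1: "two_form_power (Suc 0) (fundamental_form [t0, t1, t2]) = fundamental_form [t0, t1, t2]"
    unfolding form
    by (simp only: two_form_power.simps mult_0_right wedge_scale_right wedge_add_right w0)
  have p2: "two_form_power (Suc (Suc 0)) (fundamental_form [t0, t1, t2]) =
     wedge 2 2 (fundamental_form [t0, t1, t2]) (fundamental_form [t0, t1, t2])"
    by (subst two_form_power.simps(2)) (simp only: p1, simp)
  have "two_form_power 3 (fundamental_form [t0, t1, t2]) = wedge 4 2 (wedge 2 2
     (fundamental_form [t0, t1, t2]) (fundamental_form [t0, t1, t2])) (fundamental_form [t0, t1, t2])"
    unfolding numeral_3_eq_3 by (subst two_form_power.simps(2)) (simp only: p2, simp)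
  also have "\<dots> = (\<lambda>v. (\<i>/2)^3 * (6 * ?W v))"
    unfolding form
    by (simp only: wedge_scale_left wedge_scale_right wedge_add_left wedge_add_right w2 w4
        null orders fun_eq_iff) (simp add: algebra_simps power3_eq_cube)
  also have "(\<i>/2)^3 = - (\<i> / 8)"
    by (simp add: power3_eq_cube)
  finally show ?thesis by (simp add: fun_eq_iff)
qed

text \<open>Three jointly injective real-linear functions identify \<open>\<complex>\<^sup>3\<close> with \<open>\<complex>\<^sup>3\<close>, though possibly not complex-linearly. This covers coframes that mix forms of types (1,0) and (0,1), as happens here. Every condition becomes the corresponding one for the standard pair.\<close>

lemma SU3_conditions:
  fixes t0 t1 t2 :: "complex^3 \<Rightarrow> complex"
  assumes lin: "linear t0" "linear t1" "linear t2"
    and inj: "\<And>u. t0 u = 0 \<Longrightarrow> t1 u = 0 \<Longrightarrow> t2 u = 0 \<Longrightarrow> u = 0"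
  defines "\<Omega> \<equiv> wedge_list [t0, t1, t2]" and "\<omega> \<equiv> fundamental_form [t0, t1, t2]"
  shows "\<omega> v \<in> \<real>"
    and "u \<noteq> 0 \<Longrightarrow> interior u \<omega> \<noteq> (\<lambda>v. 0)"
    and "\<Omega> \<noteq> (\<lambda>v. 0)"
    and "wedge 3 2 \<Omega> \<omega> = (\<lambda>v. 0)"
    and "wedge 3 3 \<Omega> (conj_form \<Omega>) = (\<lambda>v. SU_const 3 * two_form_power 3 \<omega> v)"
proof -
  define \<Theta> :: "complex^3 \<Rightarrow> complex^3" where "\<Theta> u = vector [t0 u, t1 u, t2 u]" for u
  have \<Theta>: "\<Theta> u $ 1 = t0 u" "\<Theta> u $ 2 = t1 u" "\<Theta> u $ 3 = t2 u" for u
    by (simp_all add: \<Theta>_def)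
  have "linear \<Theta>"
    using lin by (simp add: linear_iff vec_eq_iff forall_3 \<Theta>)
  moreover have "inj \<Theta>"
    unfolding linear_inj_iff_eq_0[OF \<open>linear \<Theta>\<close>]
    using inj by (simp add: vec_eq_iff forall_3 \<Theta>)
  ultimately have "surj \<Theta>"
    by (rule linear_injective_imp_surjective) (rule refl)
  then have dual: "\<exists>w. t0 w = c0 \<and> t1 w = c1 \<and> t2 w = c2" for c0 c1 c2
    using surjD[of \<Theta> "vector [c0, c1, c2]"]
    by (metis \<Theta> vector_3)
  show "\<omega> v \<in> \<real>" unfolding \<omega>_def by (rule fundamental_form_real)
  show "interior u \<omega> \<noteq> (\<lambda>v. 0)" if "u \<noteq> 0"
  proof
    assume *: "interior u \<omega> = (\<lambda>v. 0)"
    \<comment> \<open>w is the image of u under the almost complex structure defined by the coframe\<close>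
    obtain w where w: "t0 w = \<i> * t0 u" "t1 w = \<i> * t1 u" "t2 w = \<i> * t2 u"
      using dual by blast
    let ?v = "case_nat u (\<lambda>_. w)"
    have v: "?v 0 = u" "?v 1 = w" by simp_all
    have "\<omega> ?v = of_real (\<Sum>t\<leftarrow>[t0, t1, t2]. (cmod (t (?v 0)))\<^sup>2)"
      unfolding \<omega>_def by (rule fundamental_form_rotated) (use w in \<open>auto simp: v\<close>)
    moreover have "\<omega> ?v = 0" using fun_cong[OF *, of "\<lambda>_. w"] by (simp add: interior_def)
    ultimately have "(cmod (t0 u))\<^sup>2 + ((cmod (t1 u))\<^sup>2 + (cmod (t2 u))\<^sup>2) = 0"
      by (simp flip: of_real_add of_real_power)
    then have "t0 u = 0 \<and> t1 u = 0 \<and> t2 u = 0"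
      by (simp add: add_nonneg_eq_0_iff)
    then show False using inj that by blast
  qed
  obtain e0 e1 e2 where e: "t0 e0 = 1" "t1 e0 = 0" "t2 e0 = 0" "t0 e1 = 0" "t1 e1 = 1" "t2 e1 = 0"
    "t0 e2 = 0" "t1 e2 = 0" "t2 e2 = 1"
    using dual by metis
  have "\<Omega> (\<lambda>i. [e0, e1, e2] ! i) = 1"
    unfolding \<Omega>_def by (rule wedge_list_dual_basis) (auto simp: less_Suc_eq e)
  then show "\<Omega> \<noteq> (\<lambda>v. 0)" by auto
  have w32: "wedge 3 2 \<Omega> (wedge_list [a, b]) = wedge_list [t0, t1, t2, a, b]" for a b
    using wedge_wedge_list[of "[t0, t1, t2]" "[a, b]"] by (simp add: \<Omega>_def eval_nat_numeral)
  have "wedge 3 2 \<Omega> (wedge_list [a, cnj_map a]) = (\<lambda>v. 0)" if "a \<in> {t0, t1, t2}" for a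
    unfolding w32 by (rule wedge_list_not_distinct) (use that in auto)
  then have null: "wedge 3 2 \<Omega> (wedge_list [t0, cnj_map t0]) v = 0"
    "wedge 3 2 \<Omega> (wedge_list [t1, cnj_map t1]) v = 0"
    "wedge 3 2 \<Omega> (wedge_list [t2, cnj_map t2]) v = 0" for v
    by simp_all
  have "\<omega> = (\<lambda>v. (\<i>/2) * (wedge_list [t0, cnj_map t0] v +
     (wedge_list [t1, cnj_map t1] v + wedge_list [t2, cnj_map t2] v)))"
    by (simp add: \<omega>_def fundamental_form_def fun_eq_iff)
  then show "wedge 3 2 \<Omega> \<omega> = (\<lambda>v. 0)"
    by (simp only: wedge_scale_right wedge_add_right null) simp
  have "wedge 3 3 \<Omega> (conj_form \<Omega>) =
      wedge_list [t0, t1, t2, cnj_map t0, cnj_map t1, cnj_map t2]"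
    using wedge_wedge_list[of "[t0, t1, t2]" "[cnj_map t0, cnj_map t1, cnj_map t2]"]
    by (simp add: \<Omega>_def wedge_list_cnj cnj_map_def eval_nat_numeral)
  also have "\<dots> = (\<lambda>v. SU_const 3 * two_form_power 3 \<omega> v)"
  proof -
    have "(- \<i>) ^ 9 = - \<i>" by (simp add: eval_nat_numeral)
    then have "SU_const 3 = - (4 * \<i> / 3)"
      by (simp add: SU_const_def fact_numeral)
    then show ?thesis
      unfolding \<omega>_def fundamental_form_cubed
      by (subst wedge_list_unshuffle) (simp add: fun_eq_iff)
  qed
  finally show "wedge 3 3 \<Omega> (conj_form \<Omega>) = (\<lambda>v. SU_const 3 * two_form_power 3 \<omega> v)" .
qed

section \<open>Hermitian geometry of complex 4-space\<close>

lemma det_4: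
  "det (A::'a::comm_ring_1^4^4) =
   (A$1$1 * A$2$2 - A$1$2 * A$2$1) * (A$3$3 * A$4$4 - A$3$4 * A$4$3)
 - (A$1$1 * A$2$3 - A$1$3 * A$2$1) * (A$3$2 * A$4$4 - A$3$4 * A$4$2)
 + (A$1$1 * A$2$4 - A$1$4 * A$2$1) * (A$3$2 * A$4$3 - A$3$3 * A$4$2)
 + (A$1$2 * A$2$3 - A$1$3 * A$2$2) * (A$3$1 * A$4$4 - A$3$4 * A$4$1)
 - (A$1$2 * A$2$4 - A$1$4 * A$2$2) * (A$3$1 * A$4$3 - A$3$3 * A$4$1)
 + (A$1$3 * A$2$4 - A$1$4 * A$2$3) * (A$3$1 * A$4$2 - A$3$2 * A$4$1)"
proof -
  have f: "finite {2::4, 3, 4}" "1 \<notin> {2::4, 3, 4}" "finite {3::4, 4}" "2 \<notin> {3::4, 4}"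
    "finite {4::4}" "3 \<notin> {4::4}"
    by auto
  show ?thesis
    unfolding det_def UNIV_4
    unfolding sum_over_permutations_insert[OF f(1,2)]
    unfolding sum_over_permutations_insert[OF f(3,4)]
    unfolding sum_over_permutations_insert[OF f(5,6)]
    unfolding permutes_sing
    by (simp add: sign_swap_id permutation_swap_id sign_compose sign_id swap_id_eq permutation_compose
       Transposition.transpose_def algebra_simps)
qed

definition herm :: "complex^'n \<Rightarrow> complex^'n \<Rightarrow> complex" where
  "herm u v = (\<Sum>j\<in>UNIV. u $ j * cnj (v $ j))"

text \<open>The vector \<open>a\<close> with \<open>\<alpha> = h(\<cdot>, a)\<close>, where \<open>h = herm\<close>.\<close>

definition alpha_dual :: "complex^4^4 \<Rightarrow> complex^4 \<Rightarrow> complex^4" where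
  "alpha_dual M z = (\<chi> j. cnj (\<Sum>i\<in>UNIV. z $ i * M $ i $ j))"

lemma herm_add: "herm (u + u') v = herm u v + herm u' v"
  by (simp add: herm_def algebra_simps sum.distrib)

lemma herm_scale: "herm (c *s u) v = c * herm u v"
  by (simp add: herm_def algebra_simps sum_distrib_left)

lemma herm_add_right: "herm u (v + w) = herm u v + herm u w"
  by (simp add: herm_def algebra_simps sum.distrib)

lemma herm_diff: "herm (u - u') v = herm u v - herm u' v"
  by (simp add: herm_def algebra_simps sum_subtractf)

lemma herm_zero [simp]: "herm 0 v = 0" "herm u 0 = 0"
  by (simp_all add: herm_def)

lemma herm_cnj: "cnj (herm u v) = herm v u"
  by (simp add: herm_def mult.commute)

lemma herm_scale_right: "herm u (c *s v) = cnj c * herm u v"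
  by (simp add: herm_def algebra_simps sum_distrib_left)

lemma herm_self: "herm u u = of_real ((norm u)\<^sup>2)"
  by (simp add: herm_def norm_vec_def L2_set_def sum_nonneg complex_norm_square del: of_real_power)

lemma herm_self_eq_0: "herm u u = 0 \<longleftrightarrow> u = 0"
  by (simp add: herm_self)

lemma herm_axis: "herm (axis i 1) v = cnj (v $ i)"
  by (simp add: herm_def axis_def if_distrib[of "\<lambda>x. x * _"] cong: if_cong)

lemma linear_herm: "linear (\<lambda>u. herm u v)"
  by (intro linearI) (simp_all add: herm_add, simp add: herm_def scaleR_sum_right)

lemma inner_eq_Re_herm: "inner u v = Re (herm u v)"
  by (simp add: inner_vec_def herm_def inner_complex_def)

lemma alpha_form_eq: "alpha_form M z v = herm (v 0) (alpha_dual M z)"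
proof -
  have "alpha_form M z v = (\<Sum>j\<in>UNIV. \<Sum>i\<in>UNIV. z $ i * M $ i $ j * v 0 $ j)"
    unfolding alpha_form_def dz_def by (rule sum.swap)
  then show ?thesis
    by (simp add: herm_def alpha_dual_def sum_distrib_left mult_ac)
qed

lemma conj_sharp_alpha: "conj_sharp (alpha_form M z) = alpha_dual M z"
  by (simp add: conj_sharp_def interior10_def interior_def alpha_form_eq herm_scale herm_axis vec_eq_iff)

lemma norm_sq_alpha: "norm_sq (alpha_form M z) = herm (alpha_dual M z) (alpha_dual M z)"
  by (simp add: norm_sq_def conj_sharp_alpha interior10_def interior_def alpha_form_eq herm_scale)

lemma alpha_dual_scale: "alpha_dual M (c *s z) = cnj c *s alpha_dual M z"
  by (simp add: alpha_dual_def vec_eq_iff sum_distrib_left mult_ac)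

lemma herm_alpha_dual_self:
  assumes "transpose M = - M"
  shows "herm z (alpha_dual M z) = 0"
proof -
  have M: "M $ i $ j = - M $ j $ i" for i j
    using assms by (metis (no_types) transpose_def vec_lambda_beta uminus_vec_def)
  let ?s = "\<Sum>j\<in>UNIV. \<Sum>i\<in>UNIV. z $ i * M $ i $ j * z $ j"
  have "?s = (\<Sum>j\<in>UNIV. \<Sum>i\<in>UNIV. z $ j * M $ j $ i * z $ i)"
    by (rule sum.swap)
  also have "\<dots> = (\<Sum>j\<in>UNIV. \<Sum>i\<in>UNIV. - (z $ i * M $ i $ j * z $ j))"
    by (intro sum.cong refl, subst M) simp
  also have "\<dots> = - ?s" by (simp add: sum_negf)
  finally have "?s = 0" by simp
  then show ?thesis
    by (simp add: herm_def alpha_dual_def sum_distrib_left mult_ac)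
qed

lemma alpha_dual_nonzero:
  assumes "invertible M" "z \<noteq> 0"
  shows "alpha_dual M z \<noteq> 0"
proof
  assume *: "alpha_dual M z = 0"
  have "(\<Sum>i\<in>UNIV. z $ i * M $ i $ j) = 0" for j
    using arg_cong[OF *, of "\<lambda>v. cnj (v $ j)"] by (simp add: alpha_dual_def)
  then have "transpose M *v z = 0"
    by (simp add: vec_eq_iff matrix_vector_mult_def transpose_def mult.commute)
  moreover have "invertible (transpose M)"
    using assms(1) by (simp add: invertible_det_nz)
  ultimately show False
    using assms(2) by (metis matrix_left_invertible_ker invertible_def)
qed

definition vol :: "complex^4 \<Rightarrow> complex^4 \<Rightarrow> complex^4 \<Rightarrow> complex^4 \<Rightarrow> complex" where
  "vol z a x y = det (vector [z, a, x, y] :: complex^4^4)"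

lemma vector_4:
  "(vector [w, x, y, z] :: 'a::zero^4) $ 1 = w" "(vector [w, x, y, z] :: 'a^4) $ 2 = x"
  "(vector [w, x, y, z] :: 'a^4) $ 3 = y" "(vector [w, x, y, z] :: 'a^4) $ 4 = z"
  unfolding vector_def by simp_all

lemma Omega0_eq_vol: "Omega0 v = vol (v 0) (v 1) (v 2) (v 3)"
proof -
  have "Omega0 = wedge_list [\<lambda>u. u $ 1, \<lambda>u. u $ 2, \<lambda>u. u $ 3, \<lambda>u. u $ 4]"
    using wedge_wedge_list[of "[\<lambda>u::complex^4. u $ 1]" "[\<lambda>u. u $ 2]"]
      wedge_wedge_list[of "[\<lambda>u::complex^4. u $ 1, \<lambda>u. u $ 2]" "[\<lambda>u. u $ 3]"]
      wedge_wedge_list[of "[\<lambda>u::complex^4. u $ 1, \<lambda>u. u $ 2, \<lambda>u. u $ 3]" "[\<lambda>u. u $ 4]"]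
    by (simp add: Omega0_def dz_def wedge_list_single eval_nat_numeral)
  then have "Omega0 v = wedge_list [\<lambda>u. u $ 1, \<lambda>u. u $ 2, \<lambda>u. u $ 3, \<lambda>u. u $ 4] v" by simp
  also have "\<dots> = vol (v 0) (v 1) (v 2) (v 3)"
  proof -
    have n: "{..<length [\<lambda>u. u $ 1, \<lambda>u. u $ 2, \<lambda>u. u $ 3, \<lambda>u::complex^4. u $ 4]} = {0, 1, 2, 3::nat}"
      by auto
    have f: "finite {1::nat, 2, 3}" "0 \<notin> {1::nat, 2, 3}" "finite {2::nat, 3}" "1 \<notin> {2::nat, 3}"
      "finite {3::nat}" "2 \<notin> {3::nat}"
      by auto
    show ?thesis
      unfolding wedge_list_def n
      unfolding sum_over_permutations_insert[OF f(1,2)]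
      unfolding sum_over_permutations_insert[OF f(3,4)]
      unfolding sum_over_permutations_insert[OF f(5,6)]
      unfolding permutes_sing
      by (simp add: sign_swap_id permutation_swap_id sign_compose sign_id swap_id_eq permutation_compose
          Transposition.transpose_def vol_def det_4 vector_4 algebra_simps)
  qed
  finally show ?thesis .
qed

lemma vol_linear:
  "vol z a (x + x') y = vol z a x y + vol z a x' y" "vol z a x (y + y') = vol z a x y + vol z a x y'"
  "vol z a (c *s x) y = c * vol z a x y" "vol z a x (c *s y) = c * vol z a x y"
  "vol (c *s z) a x y = c * vol z a x y" "vol z (c *s a) x y = c * vol z a x y"
  by (simp_all add: vol_def det_4 vector_4 algebra_simps)

lemma vol_alternating: "vol z a x x = 0" "vol z a z y = 0" "vol z a x z = 0"
   "vol z a a y = 0" "vol z a x a = 0" "vol z a y x = - vol z a x y"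
  by (simp_all add: vol_def det_4 vector_4 algebra_simps)

text \<open>The four vectors lie in the hyperplane orthogonal to \<open>f\<close>, hence are linearly dependent.\<close>

lemma vol_orthogonal_zero:
  assumes "f \<noteq> 0" "herm z f = 0" "herm a f = 0" "herm x f = 0" "herm y f = 0"
  shows "vol z a x y = 0"
proof (rule ccontr)
  let ?A = "vector [z, a, x, y] :: complex^4^4"
  let ?f = "(\<chi> j. cnj (f $ j)) :: complex^4"
  assume "vol z a x y \<noteq> 0"
  then have "invertible ?A" by (simp add: invertible_det_nz vol_def)
  moreover have "?A *v ?f = 0"
    using assms(2-5) by (simp add: vec_eq_iff forall_4 vector_4 matrix_vector_mult_def herm_def)
  ultimately have "?f = 0"
    by (metis matrix_left_invertible_ker invertible_def)
  then show False using assms(1) by (simp add: vec_eq_iff)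
qed

text \<open>Splitting \<open>x\<close> and \<open>y\<close> along \<open>f\<close> and its orthogonal complement, the term with both complement parts vanishes by \<open>vol_orthogonal_zero\<close>. For vectors of arbitrary length the formula stays rational, which later gives smooth factors without square roots.\<close>

lemma vol_decompose:
  assumes "f \<noteq> 0" "herm z f = 0" "herm a f = 0"
  shows "vol z a x y * herm f f = herm x f * vol z a f y - herm y f * vol z a f x"
proof -
  have ff: "herm f f \<noteq> 0" using assms(1) by (simp add: herm_self_eq_0)
  \<comment> \<open>the projections are scaled by h(f, f) to avoid division\<close>
  define x' where "x' = herm f f *s x - herm x f *s f"
  define y' where "y' = herm f f *s y - herm y f *s f"
  have x: "herm f f *s x = x' + herm x f *s f" and y: "herm f f *s y = y' + herm y f *s f"
    by (simp_all add: x'_def y'_def)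
  have "herm x' f = 0" "herm y' f = 0"
    by (simp_all add: x'_def y'_def herm_diff herm_scale)
  then have "vol z a x' y' = 0"
    by (rule vol_orthogonal_zero[OF assms])
  moreover have "vol z a (x' + herm x f *s f) (y' + herm y f *s f) =
      vol z a x' y' + herm x f * vol z a f (y' + herm y f *s f)
      - herm y f * vol z a f (x' + herm x f *s f)"
    by (simp add: vol_linear vol_alternating(1) vol_alternating(6)[of z a f x'] algebra_simps)
  ultimately have "herm f f * (vol z a x y * herm f f) =
      herm f f * (herm x f * vol z a f y - herm y f * vol z a f x)"
    by (simp flip: x y add: vol_linear algebra_simps)
  then show ?thesis using ff mult_left_cancel by blast
qed

text \<open>A matrix with three prescribed rows and a zero row has a nontrivial kernel.\<close>

lemma exists_orthogonal:
  fixes z a b :: "complex^4"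
  obtains f where "f \<noteq> 0" "herm z f = 0" "herm a f = 0" "herm b f = 0"
proof -
  let ?A = "vector [z, a, b, 0] :: complex^4^4"
  have "det ?A = 0" by (simp add: det_4 vector_4)
  then have "\<not> invertible ?A" by (simp add: invertible_det_nz)
  then obtain g where g: "?A *v g = 0" "g \<noteq> 0"
    by (metis matrix_left_invertible_ker invertible_left_inverse)
  have "herm z (\<chi> j. cnj (g $ j)) = 0 \<and> herm a (\<chi> j. cnj (g $ j)) = 0 \<and> herm b (\<chi> j. cnj (g $ j)) = 0"
    using g(1) by (simp add: vec_eq_iff forall_4 vector_4 matrix_vector_mult_def herm_def)
  moreover have "(\<chi> j. cnj (g $ j)) \<noteq> (0 :: complex^4)" using g(2) by (simp add: vec_eq_iff)
  ultimately show thesis using that by blast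
qed

section \<open>Adapted frames\<close>

text \<open>The Gram determinant of an orthogonal system, computed as the determinant of a matrix times its adjoint.\<close>

lemma vol_gram:
  assumes "herm z a = 0" "herm z f = 0" "herm z g = 0" "herm a f = 0" "herm a g = 0" "herm f g = 0"
  shows "vol z a f g * cnj (vol z a f g) = herm z z * herm a a * herm f f * herm g g"
proof -
  let ?A = "vector [z, a, f, g] :: complex^4^4"
  let ?B = "(\<chi> i j. cnj (?A $ j $ i)) :: complex^4^4"
  have sym: "herm a z = 0" "herm f z = 0" "herm g z = 0" "herm f a = 0" "herm g a = 0" "herm g f = 0"
    using assms herm_cnj by (metis complex_cnj_zero)+
  have AB: "(?A ** ?B) $ i $ j = herm (?A $ i) (?A $ j)" for i j
    by (simp add: matrix_matrix_mult_def herm_def)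
  have "det ?B = cnj (det ?A)" by (simp add: det_4 algebra_simps)
  then have "vol z a f g * cnj (vol z a f g) = det (?A ** ?B)"
    by (simp add: vol_def det_mul)
  also have "\<dots> = herm z z * herm a a * herm f f * herm g g"
    by (simp add: det_4 AB vector_4 assms sym)
  finally show ?thesis .
qed

text \<open>The difference of the two sides is orthogonal to all four vectors. If it were nonzero, their volume would vanish, contradicting \<open>vol_gram\<close>.\<close>

lemma orthogonal_expansion:
  fixes z a f g u :: "complex^4"
  assumes "herm z a = 0" "herm z f = 0" "herm z g = 0" "herm a f = 0" "herm a g = 0" "herm f g = 0"
    and nz: "z \<noteq> 0" "a \<noteq> 0" "f \<noteq> 0" "g \<noteq> 0"
  shows "u = (herm u z / herm z z) *s z + (herm u a / herm a a) *s a
           + (herm u f / herm f f) *s f + (herm u g / herm g g) *s g"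
proof -
  have sym: "herm a z = 0" "herm f z = 0" "herm g z = 0" "herm f a = 0" "herm g a = 0" "herm g f = 0"
    using assms herm_cnj by (metis complex_cnj_zero)+
  have ne: "herm z z \<noteq> 0" "herm a a \<noteq> 0" "herm f f \<noteq> 0" "herm g g \<noteq> 0"
    using nz by (simp_all add: herm_self_eq_0)
  define d where "d = u - ((herm u z / herm z z) *s z + (herm u a / herm a a) *s a
           + (herm u f / herm f f) *s f + (herm u g / herm g g) *s g)"
  have "herm d z = 0" "herm d a = 0" "herm d f = 0" "herm d g = 0"
    using ne by (simp_all add: d_def herm_diff herm_add herm_scale assms sym)
  then have "herm z d = 0" "herm a d = 0" "herm f d = 0" "herm g d = 0"
    using herm_cnj by (metis complex_cnj_zero)+
  moreover have "vol z a f g \<noteq> 0"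
    using vol_gram[OF assms(1-6)] ne by auto
  ultimately have "d = 0" using vol_orthogonal_zero by blast
  then show ?thesis by (simp add: d_def)
qed

lemma parseval:
  fixes z a f g u w :: "complex^4"
  assumes "herm z a = 0" "herm z f = 0" "herm z g = 0" "herm a f = 0" "herm a g = 0" "herm f g = 0"
    and nz: "z \<noteq> 0" "a \<noteq> 0" "f \<noteq> 0" "g \<noteq> 0"
  shows "herm u w = herm u z * cnj (herm w z) / herm z z + herm u a * cnj (herm w a) / herm a a
           + herm u f * cnj (herm w f) / herm f f + herm u g * cnj (herm w g) / herm g g"
  by (subst orthogonal_expansion[OF assms, of u]) (simp add: herm_add herm_scale herm_cnj)

section \<open>The forms as exterior products\<close>

definition wedge_conj :: "('e \<Rightarrow> complex) \<Rightarrow> 'e cform" where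
  "wedge_conj t = wedge_list [t, cnj_map t]"

lemma wedge_conj_eq: "wedge_conj t v = t (v 0) * cnj (t (v 1)) - t (v 1) * cnj (t (v 0))"
  by (simp add: wedge_conj_def wedge_list_two cnj_map_def)

lemma contracted_volume:
  "interior10 (conj_sharp (alpha_form M z)) (interior10 (euler z) Omega0) v =
   vol z (alpha_dual M z) (v 0) (v 1)"
  by (simp add: interior10_def interior_def Omega0_eq_vol conj_sharp_alpha euler_def vol_linear
      eval_nat_numeral)

lemma Omega_form_eq:
  "Omega_form M z = (\<lambda>v. 1 / herm (alpha_dual M z) (alpha_dual M z) *
     wedge 1 2 (\<lambda>v. cnj (herm (v 0) (alpha_dual M z))) (\<lambda>v. vol z (alpha_dual M z) (v 0) (v 1)) v)"
proof -
  have "conj_form (alpha_form M z) = (\<lambda>v. cnj (herm (v 0) (alpha_dual M z)))"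
    by (simp add: conj_form_def alpha_form_eq)
  moreover have "interior10 (conj_sharp (alpha_form M z)) (interior10 (euler z) Omega0) =
      (\<lambda>v. vol z (alpha_dual M z) (v 0) (v 1))"
    by (rule ext) (rule contracted_volume)
  ultimately show ?thesis by (simp only: Omega_form_def norm_sq_alpha)
qed

text \<open>By \<open>vol_decompose\<close> the contracted volume form is the product of \<open>h(\<cdot>, f)\<close> and the form \<open>vol z a f\<close>, up to the factor \<open>1 / h(f, f)\<close>; associativity joins it to the conjugate of \<open>\<alpha>\<close>.\<close>

lemma Omega_form_decomposed:
  assumes "f \<noteq> 0" "herm z f = 0" "herm (alpha_dual M z) f = 0"
  shows "Omega_form M z v = wedge_list [\<lambda>u. cnj (herm u (alpha_dual M z)), \<lambda>u. herm u f,
      \<lambda>u. vol z (alpha_dual M z) f u] v / (herm (alpha_dual M z) (alpha_dual M z) * herm f f)"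
proof -
  let ?a = "alpha_dual M z"
  let ?c = "\<lambda>u. cnj (herm u ?a)" and ?f = "\<lambda>u. herm u f" and ?g = "\<lambda>u. vol z ?a f u"
  have ff: "herm f f \<noteq> 0" using assms(1) by (simp add: herm_self_eq_0)
  have vd: "vol z ?a x y = (1 / herm f f) * (herm x f * ?g y - herm y f * ?g x)" for x y
    using vol_decompose[OF assms, of x y] ff by (simp add: field_simps)
  have "(\<lambda>v. vol z ?a (v 0) (v 1)) = (\<lambda>v. (1 / herm f f) * wedge_list [?f, ?g] v)"
    by (rule ext) (simp only: wedge_list_two, rule vd)
  moreover have "wedge 1 2 (\<lambda>v. ?c (v 0)) (wedge_list [?f, ?g]) = wedge_list [?c, ?f, ?g]"
    using wedge_wedge_list[of "[?c]" "[?f, ?g]"] by (simp add: wedge_list_single numeral_2_eq_2)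
  ultimately show ?thesis
    unfolding Omega_form_eq by (simp only: wedge_scale_right) simp
qed

lemma omega0_eq: "omega0 v = \<i> / 2 * (herm (v 0) (v 1) - herm (v 1) (v 0))"
proof -
  have "wedge 1 1 (dz j) (conj_form (dz j)) v =
      v 0 $ j * cnj (v 1 $ j) - v 1 $ j * cnj (v 0 $ j)" for j
    using wedge_wedge_list[of "[\<lambda>u. u $ j]" "[\<lambda>u. cnj (u $ j)]"]
    by (simp add: dz_def conj_form_def wedge_list_single wedge_list_two fun_eq_iff)
  then show ?thesis by (simp add: omega0_def herm_def sum_subtractf)
qed

lemma omega_form_eq:
  "omega_form M z v = \<i> / 2 * (herm (v 0) (v 1) - herm (v 1) (v 0))
     - \<i> / herm (alpha_dual M z) (alpha_dual M z) * wedge_conj (\<lambda>u. herm u (alpha_dual M z)) v"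
proof -
  have "wedge 1 1 (alpha_form M z) (conj_form (alpha_form M z)) v =
      wedge_conj (\<lambda>u. herm u (alpha_dual M z)) v"
    using wedge_wedge_list[of "[\<lambda>u. herm u (alpha_dual M z)]" "[\<lambda>u. cnj (herm u (alpha_dual M z))]"]
    by (simp add: alpha_form_eq[abs_def] conj_form_def wedge_list_single wedge_conj_def cnj_map_def)
  then show ?thesis by (simp add: omega_form_def omega0_eq norm_sq_alpha)
qed

text \<open>\<open>\<Omega>\<^sub>M\<close> already vanishes along the complex line through \<open>z\<close>, and it scales by \<open>|l|\<^sup>6 / |l|\<^sup>2\<close> under \<open>z \<mapsto> l z\<close>; dividing by \<open>|z|\<^sup>4\<close> makes it invariant without changing it on the unit sphere.\<close>

definition Omega_basic :: "complex^4^4 \<Rightarrow> complex^4 \<Rightarrow> (complex^4) cform" where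
  "Omega_basic M z = (\<lambda>v. Omega_form M z v / (herm z z)\<^sup>2)"

text \<open>The subtracted term is the component of \<open>\<omega>\<^sub>0\<close> along the complex line through \<open>z\<close>; what remains of \<open>\<omega>\<^sub>0 / |z|\<^sup>2\<close> is the Fubini-Study form.\<close>

definition omega_basic :: "complex^4^4 \<Rightarrow> complex^4 \<Rightarrow> (complex^4) cform" where
  "omega_basic M z = (\<lambda>v. (omega_form M z v
     - \<i> / (2 * herm z z) * wedge_conj (\<lambda>u. herm u z) v) / herm z z)"

lemma wedge_list_scale3:
  "wedge_list [\<lambda>u. c0 * t0 u, \<lambda>u. c1 * t1 u, \<lambda>u. c2 * t2 u] v = c0 * c1 * c2 * wedge_list [t0, t1, t2] v"
  by (simp add: wedge_list_def sum_distrib_left lessThan_Suc mult_ac)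

lemma linear_cnj_herm: "linear (\<lambda>u. cnj (herm u v))"
  using linear_compose[OF linear_herm, of cnj v] bounded_linear.linear[OF bounded_linear_cnj]
  by (simp add: o_def)

lemma linear_vol: "linear (\<lambda>u. vol z a f u)"
  by (intro linearI) (simp_all add: vol_linear, simp add: vol_def det_4 vector_4 algebra_simps)

text \<open>The coframe consists of the conjugate of \<open>h(\<cdot>, a)\<close>, of \<open>h(\<cdot>, f)\<close>, and of the volume form evaluated on \<open>z, a, f\<close>, suitably normalised. The last one is a multiple of \<open>h(\<cdot>, g)\<close>; defining it through the volume form fixes its phase, so that the product of the three is exactly \<open>\<Omega>\<close>, while for \<open>\<omega>\<close> only its absolute value matters, which the Gram determinant provides. The conjugate in the first form produces the sign reversal of the \<open>a\<close>-component of \<open>\<omega>\<close>. The joint kernel is the complex line through \<open>z\<close>.\<close>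

lemma unitary_frame:
  assumes M: "transpose M = - M" "invertible M" and z: "z \<noteq> 0"
  obtains t0 t1 t2 where "linear t0" "linear t1" "linear t2"
    "Omega_basic M z = wedge_list [t0, t1, t2]" "omega_basic M z = fundamental_form [t0, t1, t2]"
    "\<And>u. t0 u = 0 \<Longrightarrow> t1 u = 0 \<Longrightarrow> t2 u = 0 \<Longrightarrow> \<exists>c. u = c *s z"
proof -
  define a where "a = alpha_dual M z"
  have a: "a \<noteq> 0" "herm z a = 0"
    using alpha_dual_nonzero[OF M(2) z] herm_alpha_dual_self[OF M(1)] by (simp_all add: a_def)
  obtain f where f: "f \<noteq> 0" "herm z f = 0" "herm a f = 0"
    using exists_orthogonal[of z a a] by blast
  obtain g where g: "g \<noteq> 0" "herm z g = 0" "herm a g = 0" "herm f g = 0"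
    using exists_orthogonal[of z a f] by blast
  note orth = a(2) f(2) g(2) f(3) g(3,4) z a(1) f(1) g(1)
  define p where "p x = 1 / norm x" for x :: "complex^4"
  have pz: "p x \<noteq> 0" "of_real (p x) * of_real (p x) = 1 / herm x x" if "x \<noteq> 0" for x
    using that by (simp_all add: p_def herm_self power2_eq_square)
  define t0 where "t0 u = of_real (p a * p z) * cnj (herm u a)" for u
  define t1 where "t1 u = of_real (p f * p z) * herm u f" for u
  define t2 where "t2 u = of_real (p a * p f * p z * p z) * vol z a f u" for u
  have lin: "linear t0" "linear t1" "linear t2"
    unfolding t0_def t1_def t2_def
    by (intro linear_cmult linear_cnj_herm linear_herm linear_vol)+
  have vol_g: "vol z a f u = herm u g * vol z a f g / herm g g" for u
    by (subst orthogonal_expansion[OF orth, of u]) (simp add: vol_linear vol_alternating(1-5))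
  have vv: "vol z a f g * cnj (vol z a f g) = herm z z * herm a a * herm f f * herm g g"
    by (rule vol_gram[OF orth(1-6)])
  have ne: "herm z z \<noteq> 0" "herm a a \<noteq> 0" "herm f f \<noteq> 0" "herm g g \<noteq> 0"
    using orth(7-10) by (simp_all add: herm_self_eq_0)
  have "of_real (p a * p z) * of_real (p f * p z) * of_real (p a * p f * p z * p z) =
      (of_real (p a) * of_real (p a)) * (of_real (p f) * of_real (p f)) *
      (of_real (p z) * of_real (p z)) * (of_real (p z) * (of_real (p z) :: complex))"
    by (simp add: mult_ac)
  also have "\<dots> = 1 / (herm a a * herm f f * (herm z z)\<^sup>2)"
    by (simp add: pz(2) orth(7-9) power2_eq_square)
  finally have scal: "of_real (p a * p z) * of_real (p f * p z) * of_real (p a * p f * p z * p z) =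
      1 / (herm a a * herm f f * (herm z z)\<^sup>2)" .
  have Om: "Omega_basic M z = wedge_list [t0, t1, t2]"
  proof
    fix v
    have "Omega_basic M z v = 1 / (herm a a * herm f f * (herm z z)\<^sup>2) *
        wedge_list [\<lambda>u. cnj (herm u a), \<lambda>u. herm u f, \<lambda>u. vol z a f u] v"
      unfolding Omega_basic_def using Omega_form_decomposed[of f z M v] f by (simp add: a_def)
    then show "Omega_basic M z v = wedge_list [t0, t1, t2] v"
      unfolding t0_def[abs_def] t1_def[abs_def] t2_def[abs_def] wedge_list_scale3 scal .
  qed
  have s0: "t0 u * cnj (t0 w) = herm w a * cnj (herm u a) / (herm a a * herm z z)" for u w
  proof -
    have "t0 u * cnj (t0 w) = (of_real (p a) * of_real (p a)) * (of_real (p z) * of_real (p z)) *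
      (herm w a * cnj (herm u a))" by (simp add: t0_def mult_ac)
    then show ?thesis by (simp add: pz(2) orth)
  qed
  have s1: "t1 u * cnj (t1 w) = herm u f * cnj (herm w f) / (herm f f * herm z z)" for u w
  proof -
    have "t1 u * cnj (t1 w) = (of_real (p f) * of_real (p f)) * (of_real (p z) * of_real (p z)) *
      (herm u f * cnj (herm w f))" by (simp add: t1_def mult_ac)
    then show ?thesis by (simp add: pz(2) orth)
  qed
  have s2: "t2 u * cnj (t2 w) = herm u g * cnj (herm w g) / (herm g g * herm z z)" for u w
  proof -
    have "t2 u * cnj (t2 w) = (of_real (p a) * of_real (p a)) * (of_real (p f) * of_real (p f)) *
      (of_real (p z) * of_real (p z)) * (of_real (p z) * of_real (p z)) *
      (vol z a f u * cnj (vol z a f w))" by (simp add: t2_def mult_ac)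
    also have "vol z a f u * cnj (vol z a f w) = herm u g * cnj (herm w g) *
       (vol z a f g * cnj (vol z a f g)) / (herm g g * herm g g)"
      unfolding vol_g[of u] vol_g[of w] by (simp add: herm_cnj)
    finally show ?thesis using ne by (simp add: vv pz(2) orth)
  qed
  have om: "omega_basic M z = fundamental_form [t0, t1, t2]"
  proof
    fix v
    have "fundamental_form [t0, t1, t2] v = \<i> / 2 * (
       (t0 (v 0) * cnj (t0 (v 1)) - t0 (v 1) * cnj (t0 (v 0))) +
       (t1 (v 0) * cnj (t1 (v 1)) - t1 (v 1) * cnj (t1 (v 0))) +
       (t2 (v 0) * cnj (t2 (v 1)) - t2 (v 1) * cnj (t2 (v 0))))"
      by (simp add: fundamental_form_eq algebra_simps)
    also have "\<dots> = omega_basic M z v"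
      unfolding s0 s1 s2 omega_basic_def omega_form_eq wedge_conj_eq a_def[symmetric]
        parseval[OF orth, of "v 0" "v 1"] parseval[OF orth, of "v 1" "v 0"]
      using ne by (simp add: field_simps)
    finally show "omega_basic M z v = fundamental_form [t0, t1, t2] v" ..
  qed
  have "\<exists>c. u = c *s z" if "t0 u = 0" "t1 u = 0" "t2 u = 0" for u
  proof -
    have "vol z a f g \<noteq> 0" using vv ne by auto
    moreover have "herm u a = 0" "herm u f = 0" "vol z a f u = 0"
      using that pz(1) orth by (auto simp: t0_def t1_def t2_def)
    ultimately have "herm u a = 0" "herm u f = 0" "herm u g = 0"
      using vol_g[of u] ne by auto
    then have "u = (herm u z / herm z z) *s z"
      using orthogonal_expansion[OF orth, of u] by simp
    then show ?thesis by blast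
  qed
  then show thesis using that[OF lin Om om] by blast
qed

section \<open>Homogeneous basic forms\<close>

lemma Omega_basic_eq:
  "Omega_basic M z = (\<lambda>v. 1 / (herm (alpha_dual M z) (alpha_dual M z) * (herm z z)\<^sup>2) *
     wedge 1 2 (\<lambda>v. cnj (herm (v 0) (alpha_dual M z))) (\<lambda>v. vol z (alpha_dual M z) (v 0) (v 1)) v)"
  by (simp add: Omega_basic_def Omega_form_eq)

text \<open>Under \<open>z \<mapsto> l z\<close>, with \<open>u\<close> replaced by \<open>l u\<close> up to a multiple of \<open>z\<close>, the conjugate of \<open>\<alpha>\<close> scales by \<open>l'\<^sup>2\<close> (with \<open>l'\<close> the conjugate of \<open>l\<close>) and the contracted volume form by \<open>l\<^sup>3 l'\<close>. This is balanced by \<open>|\<alpha>|\<^sup>2 |z|\<^sup>4\<close>, which scales by \<open>(l l')\<^sup>3\<close>. It is here that the charge 2 of \<open>\<alpha>\<close> enters.\<close>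

lemma Omega_basic_invariant:
  assumes M: "transpose M = - M" and l: "l \<noteq> 0"
  shows "pull_form (\<lambda>u. l *s u + \<psi> u *s z) (Omega_basic M (l *s z)) = Omega_basic M z"
proof -
  let ?a = "alpha_dual M z" and ?B = "\<lambda>u. l *s u + \<psi> u *s z"
  let ?\<eta> = "\<lambda>v. cnj (herm (v 0) ?a)" and ?\<theta> = "\<lambda>v. vol z ?a (v 0) (v 1)"
  have \<eta>: "pull_form ?B (\<lambda>v. cnj (herm (v 0) (alpha_dual M (l *s z)))) = (\<lambda>v. (cnj l)\<^sup>2 * ?\<eta> v)"
    by (simp add: pull_form_def alpha_dual_scale herm_add herm_scale herm_scale_right
        herm_alpha_dual_self[OF M] power2_eq_square fun_eq_iff)
  have \<theta>: "pull_form ?B (\<lambda>v. vol (l *s z) (alpha_dual M (l *s z)) (v 0) (v 1)) =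
      (\<lambda>v. (l ^ 3 * cnj l) * ?\<theta> v)"
    by (simp add: pull_form_def alpha_dual_scale vol_linear vol_alternating(1-5) fun_eq_iff
        power3_eq_cube)
  have "pull_form ?B (Omega_basic M (l *s z)) = (\<lambda>v. 1 / (herm (alpha_dual M (l *s z)) (alpha_dual M (l *s z))
      * (herm (l *s z) (l *s z))\<^sup>2) * pull_form ?B (wedge 1 2 (\<lambda>v. cnj (herm (v 0) (alpha_dual M (l *s z))))
      (\<lambda>v. vol (l *s z) (alpha_dual M (l *s z)) (v 0) (v 1))) v)"
    by (simp add: Omega_basic_eq pull_form_def)
  also have "\<dots> = (\<lambda>v. (1 / (cnj l * l * herm ?a ?a * (l * cnj l * herm z z)\<^sup>2) * (cnj l)\<^sup>2 * (l ^ 3 * cnj l))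
      * wedge 1 2 ?\<eta> ?\<theta> v)"
    unfolding wedge_pull \<eta> \<theta> wedge_scale_left wedge_scale_right
    by (simp add: alpha_dual_scale herm_scale herm_scale_right mult_ac)
  also have "1 / (cnj l * l * herm ?a ?a * (l * cnj l * herm z z)\<^sup>2) * (cnj l)\<^sup>2 * (l ^ 3 * cnj l) =
      1 / (herm ?a ?a * (herm z z)\<^sup>2)"
    using l by (simp add: field_simps power2_eq_square power3_eq_cube)
  finally show ?thesis by (simp only: Omega_basic_eq)
qed

text \<open>The Hermitian product of the projections of \<open>u\<close> and \<open>w\<close> to the orthogonal complement of \<open>z\<close>.\<close>

definition projected_herm :: "complex^'n \<Rightarrow> complex^'n \<Rightarrow> complex^'n \<Rightarrow> complex" where
  "projected_herm z u w = herm u w - herm u z * cnj (herm w z) / herm z z"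

lemma projected_herm_invariant:
  assumes "l \<noteq> 0" "z \<noteq> 0"
  shows "projected_herm (l *s z) (l *s u + s *s z) (l *s w + t *s z) = l * cnj l * projected_herm z u w"
proof -
  have "herm z z \<noteq> 0" "herm z w = cnj (herm w z)" "cnj (herm z z) = herm z z"
    using assms by (simp_all add: herm_self_eq_0 herm_cnj)
  then show ?thesis
    using assms(1)
    by (simp add: projected_herm_def herm_add herm_add_right herm_scale herm_scale_right field_simps)
qed

lemma omega_basic_eq:
  "omega_basic M z v = (\<i> / 2 * (projected_herm z (v 0) (v 1) - projected_herm z (v 1) (v 0))
     - \<i> / herm (alpha_dual M z) (alpha_dual M z) * wedge_conj (\<lambda>u. herm u (alpha_dual M z)) v) / herm z z"
  by (cases "herm z z = 0")
    (simp_all add: omega_basic_def omega_form_eq projected_herm_def wedge_conj_eq field_simps)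

lemma omega_basic_invariant:
  assumes M: "transpose M = - M" and l: "l \<noteq> 0" and z: "z \<noteq> 0"
  shows "pull_form (\<lambda>u. l *s u + \<psi> u *s z) (omega_basic M (l *s z)) = omega_basic M z"
proof
  fix v :: "nat \<Rightarrow> complex^4"
  let ?a = "alpha_dual M z" and ?v = "\<lambda>i. l *s v i + \<psi> (v i) *s z"
  have "wedge_conj (\<lambda>u. herm u (alpha_dual M (l *s z))) ?v = (l * cnj l)\<^sup>2 * wedge_conj (\<lambda>u. herm u ?a) v"
    by (simp add: wedge_conj_eq alpha_dual_scale herm_add herm_scale herm_scale_right
        herm_alpha_dual_self[OF M] power2_eq_square algebra_simps)
  moreover have "herm (alpha_dual M (l *s z)) (alpha_dual M (l *s z)) = l * cnj l * herm ?a ?a"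
    "herm (l *s z) (l *s z) = l * cnj l * herm z z"
    by (simp_all add: alpha_dual_scale herm_scale herm_scale_right)
  ultimately have "omega_basic M (l *s z) ?v = (\<i> / 2 * (l * cnj l * projected_herm z (v 0) (v 1)
      - l * cnj l * projected_herm z (v 1) (v 0)) - \<i> / (l * cnj l * herm ?a ?a) *
      ((l * cnj l)\<^sup>2 * wedge_conj (\<lambda>u. herm u ?a) v)) / (l * cnj l * herm z z)"
    by (simp only: omega_basic_eq projected_herm_invariant[OF l z])
  also have "\<dots> = (l * cnj l) * (\<i> / 2 * (projected_herm z (v 0) (v 1)
      - projected_herm z (v 1) (v 0)) - \<i> / herm ?a ?a * wedge_conj (\<lambda>u. herm u ?a) v)
      / (l * cnj l * herm z z)"
    using l by (simp add: power2_eq_square algebra_simps)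
  also have "\<dots> = omega_basic M z v"
    unfolding omega_basic_eq by (rule mult_divide_mult_cancel_left) (use l in simp)
  finally show "pull_form (\<lambda>u. l *s u + \<psi> u *s z) (omega_basic M (l *s z)) v = omega_basic M z v"
    by (simp add: pull_form_def)
qed

lemma Omega_basic_on_sphere: "norm z = 1 \<Longrightarrow> Omega_basic M z v = Omega_form M z v"
  by (simp add: Omega_basic_def herm_self)

text \<open>On real tangent vectors of the sphere \<open>h(\<cdot>, z)\<close> is purely imaginary, and the correction term vanishes.\<close>

lemma omega_basic_on_sphere:
  assumes "norm z = 1" "inner z (v 0) = 0" "inner z (v 1) = 0"
  shows "omega_basic M z v = omega_form M z v"
proof -
  have "Re (herm u z) = 0" if "inner z u = 0" for u
    using that inner_eq_Re_herm[of u z] by (simp add: inner_commute)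
  then have "wedge_conj (\<lambda>u. herm u z) v = 0"
    using assms by (simp add: wedge_conj_eq complex_eq_iff)
  then show ?thesis using assms(1) by (simp add: omega_basic_def herm_self)
qed

lemma alternating_wedge_conj:
  assumes "linear t"
  shows "alternating 2 (wedge_conj t)"
proof -
  have "linear (cnj_map t)"
    using linear_compose[OF assms, of cnj] bounded_linear.linear[OF bounded_linear_cnj]
    by (simp add: o_def cnj_map_def)
  then show ?thesis
    using alternating_wedge_list[of "[t, cnj_map t]"] assms
    by (auto simp: wedge_conj_def numeral_2_eq_2)
qed

lemma alternating_omega_form: "alternating 2 (omega_form M z)"
proof -
  have comp: "herm (v 0) (v 1) - herm (v 1) (v 0) = (\<Sum>j\<in>UNIV. wedge_conj (\<lambda>u. u $ j) v)"
    for v :: "nat \<Rightarrow> complex^4"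
    by (simp add: herm_def wedge_conj_eq sum_subtractf)
  have "linear (\<lambda>u::complex^4. u $ j)" for j
    by (intro linearI) simp_all
  then show ?thesis
    unfolding omega_form_eq[abs_def] comp
    by (intro alternating_diff alternating_cmult alternating_sum alternating_wedge_conj linear_herm)
qed

lemma alternating_omega_basic: "alternating 2 (omega_basic M z)"
proof -
  have "omega_basic M z = (\<lambda>v. (1 / herm z z) *
      (omega_form M z v - \<i> / (2 * herm z z) * wedge_conj (\<lambda>u. herm u z) v))"
    by (simp add: omega_basic_def fun_eq_iff)
  then show ?thesis
    by (simp only:)
      (intro alternating_cmult alternating_diff alternating_omega_form alternating_wedge_conj linear_herm)
qed

text \<open>Read off from the decomposition with an arbitrary admissible \<open>f\<close>.\<close>

lemma alternating_Omega_form: "alternating 3 (Omega_form M z)"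
proof -
  let ?a = "alpha_dual M z"
  obtain f where f: "f \<noteq> 0" "herm z f = 0" "herm ?a f = 0"
    using exists_orthogonal[of z ?a ?a] by blast
  have "Omega_form M z = (\<lambda>v. (1 / (herm ?a ?a * herm f f)) *
      wedge_list [\<lambda>u. cnj (herm u ?a), \<lambda>u. herm u f, \<lambda>u. vol z ?a f u] v)"
    by (simp add: Omega_form_decomposed[OF f] fun_eq_iff)
  moreover have "alternating 3 (wedge_list [\<lambda>u. cnj (herm u ?a), \<lambda>u. herm u f, \<lambda>u. vol z ?a f u])"
    using alternating_wedge_list[of "[\<lambda>u. cnj (herm u ?a), \<lambda>u. herm u f, \<lambda>u. vol z ?a f u]"]
      linear_cnj_herm[of ?a] linear_herm[of f] linear_vol[of z ?a f]
    by (force simp: numeral_3_eq_3)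
  ultimately show ?thesis by (simp only: alternating_cmult)
qed

lemma alternating_Omega_basic: "alternating 3 (Omega_basic M z)"
  using alternating_cmult[OF alternating_Omega_form, of "1 / (herm z z)\<^sup>2"]
  by (simp add: Omega_basic_def)

section \<open>Smooth dependence on the point\<close>

text \<open>Smoothness of a vector-valued map through its coordinates, so that the forms, which are rational in the coordinates and their conjugates, can be treated along any such map: the identity as well as the affine lifts.\<close>

definition smooth_coords :: "('a::real_normed_vector \<Rightarrow> complex^'n) \<Rightarrow> 'a set \<Rightarrow> bool" where
  "smooth_coords w S \<longleftrightarrow> (\<forall>i. smooth_on (\<lambda>x. w x $ i) S)"

lemma smooth_coords_const: "open S \<Longrightarrow> smooth_coords (\<lambda>x. c) S"
  by (simp add: smooth_coords_def smooth_on_const)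

lemma smooth_herm:
  "open S \<Longrightarrow> smooth_coords u S \<Longrightarrow> smooth_coords w S \<Longrightarrow> smooth_on (\<lambda>x. herm (u x) (w x)) S"
  unfolding herm_def smooth_coords_def
  by (intro smooth_on_sum smooth_on_mult smooth_on_cnj) auto

lemma smooth_alpha_dual: "open S \<Longrightarrow> smooth_coords w S \<Longrightarrow> smooth_coords (\<lambda>x. alpha_dual M (w x)) S"
  unfolding alpha_dual_def smooth_coords_def vec_lambda_beta
  by (intro allI smooth_on_sum smooth_on_mult smooth_on_cnj smooth_on_const) auto

lemma smooth_vol:
  assumes "open S" "smooth_coords z S" "smooth_coords a S" "smooth_coords x S" "smooth_coords y S"
  shows "smooth_on (\<lambda>s. vol (z s) (a s) (x s) (y s)) S"
  unfolding vol_def det_4 vector_4 using assms unfolding smooth_coords_def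
  by (intro smooth_on_add smooth_on_diff smooth_on_mult assms(1)) simp_all

lemma smooth_Omega_form:
  assumes S: "open S" and w: "smooth_coords w S" "\<And>x. x \<in> S \<Longrightarrow> w x \<noteq> 0" and M: "invertible M"
  shows "smooth_on (\<lambda>x. Omega_form M (w x) v) S"
  unfolding Omega_form_eq wedge_def
  using herm_self_eq_0 alpha_dual_nonzero[OF M w(2)]
  by (intro smooth_on_mult smooth_on_divide smooth_on_sum smooth_on_cnj smooth_on_const
      smooth_herm smooth_vol smooth_alpha_dual smooth_coords_const S w(1)) auto

lemma smooth_Omega_basic:
  assumes S: "open S" and w: "smooth_coords w S" "\<And>x. x \<in> S \<Longrightarrow> w x \<noteq> 0" and M: "invertible M"
  shows "smooth_on (\<lambda>x. Omega_basic M (w x) v) S"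
  unfolding Omega_basic_def
  using w(2) herm_self_eq_0
  by (intro smooth_on_divide smooth_on_power smooth_Omega_form smooth_herm assms) auto

lemma smooth_omega_form:
  assumes S: "open S" and w: "smooth_coords w S" "\<And>x. x \<in> S \<Longrightarrow> w x \<noteq> 0" and M: "invertible M"
  shows "smooth_on (\<lambda>x. omega_form M (w x) v) S"
  unfolding omega_form_eq wedge_conj_eq
  using herm_self_eq_0 alpha_dual_nonzero[OF M w(2)]
  by (intro smooth_on_mult smooth_on_divide smooth_on_diff smooth_on_cnj smooth_on_const
      smooth_herm smooth_alpha_dual smooth_coords_const S w(1)) auto

lemma smooth_omega_basic:
  assumes S: "open S" and w: "smooth_coords w S" "\<And>x. x \<in> S \<Longrightarrow> w x \<noteq> 0" and M: "invertible M"
  shows "smooth_on (\<lambda>x. omega_basic M (w x) v) S"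
  unfolding omega_basic_def wedge_conj_eq
  using w(2) herm_self_eq_0
  by (intro smooth_on_mult smooth_on_divide smooth_on_diff smooth_on_cnj smooth_on_const
      smooth_omega_form smooth_herm smooth_coords_const assms) auto

section \<open>The atlas of projective space\<close>

definition affine_coords :: "4 \<Rightarrow> (3 \<Rightarrow> 4) \<Rightarrow> complex^4 \<Rightarrow> complex^3" where
  "affine_coords k r z = (\<chi> j. z $ r j / z $ k)"

definition affine_embed :: "4 \<Rightarrow> (3 \<Rightarrow> 4) \<Rightarrow> complex^3 \<Rightarrow> complex^4" where
  "affine_embed k r w = (\<chi> i. if i = k then 0 else w $ inv r i)"

definition affine_lift :: "4 \<Rightarrow> (3 \<Rightarrow> 4) \<Rightarrow> complex^3 \<Rightarrow> complex^4" where
  "affine_lift k r w = axis k 1 + affine_embed k r w"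

definition chart_index :: "4 \<Rightarrow> (3 \<Rightarrow> 4) \<Rightarrow> bool" where
  "chart_index k r \<longleftrightarrow> bij_betw r UNIV (- {k})"

lemma chart_indexD:
  assumes "chart_index k r"
  shows "r j \<noteq> k" "inv r (r j) = j" "i \<noteq> k \<Longrightarrow> r (inv r i) = i"
proof -
  have inj: "inj r" and im: "range r = - {k}"
    using assms by (auto simp: chart_index_def bij_betw_def)
  show "r j \<noteq> k" using im by auto
  show "inv r (r j) = j" using inj by simp
  show "r (inv r i) = i" if "i \<noteq> k" using im that by (intro f_inv_into_f) auto
qed

lemma affine_lift_nth: "affine_lift k r w $ i = (if i = k then 1 else w $ inv r i)"
  by (simp add: affine_lift_def affine_embed_def axis_def)

lemma affine_lift_nonzero: "affine_lift k r w \<noteq> 0"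
  by (metis affine_lift_nth zero_index zero_neq_one)

lemma linear_affine_embed: "linear (affine_embed k r)"
  by (intro linearI) (simp_all add: affine_embed_def vec_eq_iff)

lemma affine_coords_lift: "chart_index k r \<Longrightarrow> affine_coords k r (affine_lift k r w) = w"
  by (simp add: affine_coords_def affine_lift_nth vec_eq_iff chart_indexD)

lemma affine_lift_coords:
  "chart_index k r \<Longrightarrow> z $ k \<noteq> 0 \<Longrightarrow> affine_lift k r (affine_coords k r z) = (1 / z $ k) *s z"
  by (simp add: affine_coords_def affine_lift_nth vec_eq_iff chart_indexD)

lemma affine_coords_scale: "c \<noteq> 0 \<Longrightarrow> affine_coords k r (c *s z) = affine_coords k r z"
  by (simp add: affine_coords_def)

lemma norm_scale_vec: "norm (c *s z) = cmod c * norm (z :: complex^'n)"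
proof -
  have "complex_of_real ((norm (c *s z))\<^sup>2) = of_real ((cmod c * norm z)\<^sup>2)"
    by (simp only: herm_self[symmetric] herm_scale herm_scale_right)
      (simp add: power_mult_distrib herm_self complex_norm_square mult_ac del: of_real_power)
  then have "(norm (c *s z))\<^sup>2 = (cmod c * norm z)\<^sup>2" by (simp only: of_real_eq_iff)
  then show ?thesis by (simp add: power2_eq_iff_nonneg)
qed

lemma hopf_self: "p \<in> hopf p"
proof -
  have "p = 1 *s p" by simp
  then show ?thesis unfolding hopf_def by (metis (mono_tags) mem_Collect_eq norm_one)
qed

lemma hopf_scale: "cmod u = 1 \<Longrightarrow> hopf (u *s p) = hopf p"
proof -
  assume u: "cmod u = 1"
  then have nz: "u \<noteq> 0" by auto
  show ?thesis
  proof (rule set_eqI)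
    fix x
    show "x \<in> hopf (u *s p) \<longleftrightarrow> x \<in> hopf p"
    proof
      assume "x \<in> hopf (u *s p)"
      then obtain v where "x = (v * u) *s p" "cmod v = 1" by (auto simp: hopf_def)
      then show "x \<in> hopf p" using u unfolding hopf_def by (auto simp: norm_mult intro!: exI[of _ "v * u"])
    next
      assume "x \<in> hopf p"
      then obtain v where "x = v *s p" "cmod v = 1" by (auto simp: hopf_def)
      then have "x = (v / u) *s (u *s p)" "cmod (v / u) = 1"
        using u nz by (simp_all add: norm_divide)
      then show "x \<in> hopf (u *s p)" unfolding hopf_def by blast
    qed
  qed
qed

lemma hopf_eqD: "hopf p = hopf q \<Longrightarrow> \<exists>u. cmod u = 1 \<and> p = u *s q"
  using hopf_self[of p] unfolding hopf_def by auto

lemma snd_affine_chart_hopf: "snd (affine_chart k r) (hopf p) = affine_coords k r p"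
proof -
  have "(SOME z. z \<in> hopf p) \<in> hopf p" using hopf_self by (rule someI)
  then obtain u where u: "(SOME z. z \<in> hopf p) = u *s p" "cmod u = 1" by (auto simp: hopf_def)
  then have "u \<noteq> 0" by auto
  then show ?thesis
    using affine_coords_scale[of u k r p] u(1) by (simp add: affine_chart_def affine_coords_def Let_def)
qed

lemma fst_affine_chart: "fst (affine_chart k r) = hopf ` {p. norm p = 1 \<and> p $ k \<noteq> 0}"
  by (simp add: affine_chart_def)

lemma hopf_in_affine_chart:
  assumes "norm p = 1"
  shows "hopf p \<in> fst (affine_chart k r) \<longleftrightarrow> p $ k \<noteq> 0"
proof
  assume "hopf p \<in> fst (affine_chart k r)"
  then obtain q where "hopf p = hopf q" "q $ k \<noteq> 0" by (auto simp: fst_affine_chart)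
  then obtain u where u: "cmod u = 1" "p = u *s q" using hopf_eqD by blast
  then have "u \<noteq> 0" by auto
  then show "p $ k \<noteq> 0" using u(2) \<open>q $ k \<noteq> 0\<close> by simp
qed (use assms in \<open>auto simp: fst_affine_chart\<close>)

definition sphere_point :: "complex^4 \<Rightarrow> complex^4" where
  "sphere_point z = of_real (1 / norm z) *s z"

lemma norm_sphere_point: "z \<noteq> 0 \<Longrightarrow> norm (sphere_point z) = 1"
  by (simp add: sphere_point_def norm_scale_vec norm_divide)

lemma affine_coords_sphere_point: "affine_coords k r (sphere_point z) = affine_coords k r z"
proof (cases "z = 0")
  case False
  then have "complex_of_real (1 / norm z) \<noteq> 0" by simp
  then show ?thesis unfolding sphere_point_def by (rule affine_coords_scale)
qed (simp add: sphere_point_def)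

lemma chart_point:
  assumes "chart_index k r"
  defines "P \<equiv> \<lambda>w. hopf (sphere_point (affine_lift k r w))"
  shows "P w \<in> fst (affine_chart k r)" "snd (affine_chart k r) (P w) = w"
    "P w \<in> fst (affine_chart k' r') \<longleftrightarrow> affine_lift k r w $ k' \<noteq> 0"
proof -
  have n: "norm (sphere_point (affine_lift k r w)) = 1"
    by (rule norm_sphere_point[OF affine_lift_nonzero])
  show 1: "P w \<in> fst (affine_chart k' r') \<longleftrightarrow> affine_lift k r w $ k' \<noteq> 0" for k' r'
    unfolding P_def hopf_in_affine_chart[OF n]
    by (simp add: sphere_point_def affine_lift_nonzero)
  show "P w \<in> fst (affine_chart k r)" unfolding 1 by (simp add: affine_lift_nth)
  show "snd (affine_chart k r) (P w) = w"
    by (simp add: P_def snd_affine_chart_hopf affine_coords_sphere_point affine_coords_lift assms(1))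
qed

lemma inj_on_affine_chart:
  assumes "chart_index k r"
  shows "inj_on (snd (affine_chart k r)) (fst (affine_chart k r))"
proof (rule inj_onI)
  fix P Q assume "P \<in> fst (affine_chart k r)" "Q \<in> fst (affine_chart k r)"
    and eq: "snd (affine_chart k r) P = snd (affine_chart k r) Q"
  then obtain p q where pq: "P = hopf p" "Q = hopf q" "norm p = 1" "norm q = 1" "p $ k \<noteq> 0" "q $ k \<noteq> 0"
    by (auto simp: fst_affine_chart)
  then have "affine_lift k r (affine_coords k r p) = affine_lift k r (affine_coords k r q)"
    using eq by (simp add: snd_affine_chart_hopf)
  then have eq2: "(1 / p $ k) *s p = (1 / q $ k) *s q"
    using pq by (simp add: affine_lift_coords[OF assms])
  define u where "u = p $ k / q $ k"
  have "p = (p $ k) *s ((1 / p $ k) *s p)" using pq(5) by simp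
  also have "\<dots> = u *s q" unfolding eq2 by (simp add: u_def)
  finally have p: "p = u *s q" .
  then have "cmod u = 1" using pq(3,4) norm_scale_vec[of u q] by simp
  then show "P = Q" using p pq(1,2) by (simp add: hopf_scale)
qed

lemma affine_chart_image_Int:
  assumes "chart_index k r"
  shows "snd (affine_chart k r) ` (fst (affine_chart k r) \<inter> fst (affine_chart k' r')) =
    {w. affine_lift k r w $ k' \<noteq> 0}"
proof
  show "snd (affine_chart k r) ` (fst (affine_chart k r) \<inter> fst (affine_chart k' r')) \<subseteq>
    {w. affine_lift k r w $ k' \<noteq> 0}"
  proof
    fix w assume "w \<in> snd (affine_chart k r) ` (fst (affine_chart k r) \<inter> fst (affine_chart k' r'))"
    then obtain P where P: "P \<in> fst (affine_chart k r)" "P \<in> fst (affine_chart k' r')"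
      "w = snd (affine_chart k r) P" by blast
    have "snd (affine_chart k r) P =
        snd (affine_chart k r) (hopf (sphere_point (affine_lift k r w)))"
      using P(3) chart_point(2)[OF assms, of w] by simp
    then have "P = hopf (sphere_point (affine_lift k r w))"
      using P(1) chart_point(1)[OF assms] by (rule inj_onD[OF inj_on_affine_chart[OF assms]])
    then show "w \<in> {w. affine_lift k r w $ k' \<noteq> 0}"
      using P(2) chart_point(3)[OF assms, of w] by simp
  qed
next
  show "{w. affine_lift k r w $ k' \<noteq> 0} \<subseteq>
    snd (affine_chart k r) ` (fst (affine_chart k r) \<inter> fst (affine_chart k' r'))"
  proof
    fix w assume "w \<in> {w. affine_lift k r w $ k' \<noteq> 0}"
    then have "hopf (sphere_point (affine_lift k r w)) \<in> fst (affine_chart k r) \<inter> fst (affine_chart k' r')"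
      using chart_point(1,3)[OF assms, of w] by simp
    then show "w \<in> snd (affine_chart k r) ` (fst (affine_chart k r) \<inter> fst (affine_chart k' r'))"
      using chart_point(2)[OF assms, of w] by (metis image_eqI)
  qed
qed

lemma affine_chart_image: "chart_index k r \<Longrightarrow> snd (affine_chart k r) ` fst (affine_chart k r) = UNIV"
  using affine_chart_image_Int[of k r k r] by (simp add: affine_lift_nth)

lemma transition_affine:
  assumes "chart_index k r"
  shows "transition (affine_chart k r) (affine_chart k' r') w =
    affine_coords k' r' (affine_lift k r w)"
proof -
  have "inv_into (fst (affine_chart k r)) (snd (affine_chart k r)) w =
      hopf (sphere_point (affine_lift k r w))"
    using chart_point(1,2)[OF assms, of w] inj_on_affine_chart[OF assms] by (intro inv_into_f_eq)
  then show ?thesis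
    by (simp add: transition_def snd_affine_chart_hopf affine_coords_sphere_point)
qed

lemma smooth_coords_affine_lift:
  assumes "open S"
  shows "smooth_coords (affine_lift k r) S"
  unfolding smooth_coords_def
proof
  fix i
  show "smooth_on (\<lambda>w. affine_lift k r w $ i) S"
    using smooth_on_const[OF assms] smooth_on_linear[OF assms bounded_linear_vec_nth]
    by (cases "i = k") (simp_all add: affine_lift_nth)
qed

lemma smooth_transition:
  "open S \<Longrightarrow> (\<And>w. w \<in> S \<Longrightarrow> affine_lift k r w $ k' \<noteq> 0) \<Longrightarrow>
    smooth_on (\<lambda>w. affine_coords k' r' (affine_lift k r w)) S"
  unfolding affine_coords_def using smooth_coords_affine_lift[of S k r]
  by (intro smooth_on_vec smooth_on_divide) (auto simp: smooth_coords_def)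

text \<open>Since \<open>affine_lift k r\<close> composed with \<open>affine_coords k r\<close> is \<open>z \<mapsto> z / z\<^sub>k\<close>, the derivative of the coordinates, lifted back, is scaling by \<open>1 / z\<^sub>k\<close> up to a multiple of \<open>z\<close>. Basic forms do not see that multiple.\<close>

lemma affine_coords_derivative:
  assumes "chart_index k r" "z $ k \<noteq> 0"
  obtains D where "(affine_coords k r has_derivative D) (at z)"
    "\<And>v. affine_embed k r (D v) = (1 / z $ k) *s v + (- (v $ k) / (z $ k)\<^sup>2) *s z"
proof
  define D :: "complex^4 \<Rightarrow> complex^3" where
    "D v = (\<chi> j. v $ r j / z $ k - z $ r j * v $ k / (z $ k)\<^sup>2)" for v
  have lin: "bounded_linear (\<lambda>c::complex. axis j c :: complex^3)" for j
    by (intro linear_conv_bounded_linear[THEN iffD1] linearI) (auto simp: axis_def vec_eq_iff)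
  have nth: "((\<lambda>z::complex^4. z $ i) has_derivative (\<lambda>v. v $ i)) (at z)" for i
    by (rule bounded_linear_imp_has_derivative[OF bounded_linear_vec_nth])
  have comp: "((\<lambda>z. z $ r j / z $ k) has_derivative
     (\<lambda>v. v $ r j / z $ k - z $ r j * v $ k / (z $ k)\<^sup>2)) (at z)" for j
    by (rule has_derivative_eq_rhs[OF has_derivative_divide[OF nth nth assms(2)]])
      (use assms(2) in \<open>simp add: fun_eq_iff field_simps power2_eq_square\<close>)
  have "((\<lambda>z. \<Sum>j\<in>UNIV. axis j (z $ r j / z $ k)) has_derivative
      (\<lambda>v. \<Sum>j\<in>UNIV. axis j (v $ r j / z $ k - z $ r j * v $ k / (z $ k)\<^sup>2))) (at z)"
    by (rule has_derivative_sum) (rule bounded_linear.has_derivative[OF lin comp])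
  moreover have "(\<lambda>z. \<Sum>j\<in>UNIV. axis j (z $ r j / z $ k)) = affine_coords k r"
    by (auto simp: affine_coords_def vec_eq_iff axis_def)
  moreover have "(\<lambda>v. \<Sum>j\<in>UNIV. axis j (v $ r j / z $ k - z $ r j * v $ k / (z $ k)\<^sup>2)) = D"
    by (auto simp: D_def vec_eq_iff axis_def fun_eq_iff)
  ultimately show "(affine_coords k r has_derivative D) (at z)" by simp
  show "affine_embed k r (D v) = (1 / z $ k) *s v + (- (v $ k) / (z $ k)\<^sup>2) *s z" for v
    using assms(2)
    by (auto simp: affine_embed_def D_def vec_eq_iff chart_indexD(3)[OF assms(1)]
        power2_eq_square)
qed

lemma exists_chart_index: "\<exists>r. chart_index k r"
proof -
  have "card (- {k}) = 3" by (simp add: Compl_eq_Diff_UNIV card_Diff_subset)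
  then have "card (UNIV :: 3 set) = card (- {k})" by simp
  then show ?thesis
    unfolding chart_index_def using finite_same_card_bij[of "UNIV :: 3 set" "- {k}"] by auto
qed

lemma CP3_atlas_eq: "CP3_atlas = {affine_chart k r | k r. chart_index k r}"
  by (simp add: CP3_atlas_def chart_index_def)

text \<open>The entries of the orthogonal projector onto the complex line through \<open>z\<close>: continuous functions on projective space that separate its points, even where no common affine chart exists.\<close>

definition projector_entry :: "4 \<Rightarrow> 4 \<Rightarrow> complex^4 \<Rightarrow> complex" where
  "projector_entry i j z = z $ i * cnj (z $ j) / herm z z"

lemma projector_entry_scale: "c \<noteq> 0 \<Longrightarrow> projector_entry i j (c *s z) = projector_entry i j z"
  by (simp add: projector_entry_def herm_scale herm_scale_right)

lemma projector_entry_separates: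
  assumes "norm p = 1" "norm q = 1" "\<And>i j. projector_entry i j p = projector_entry i j q"
  shows "hopf p = hopf q"
proof -
  have eq: "p $ i * cnj (p $ j) = q $ i * cnj (q $ j)" for i j
    using assms(3)[of i j] assms(1,2) by (simp add: projector_entry_def herm_self)
  have "p \<noteq> 0" using assms(1) by auto
  then obtain j where j: "p $ j \<noteq> 0" by (auto simp: vec_eq_iff)
  define u where "u = cnj (q $ j) / cnj (p $ j)"
  have "p $ i = u * q $ i" for i using eq[of i j] j by (simp add: u_def field_simps)
  then have p: "p = u *s q" by (simp add: vec_eq_iff)
  then have "cmod u = 1" using assms(1,2) norm_scale_vec[of u q] by simp
  then show ?thesis using p by (simp add: hopf_scale)
qed

lemma open_projector_entry_vimage:
  assumes "open U"
  shows "open {w. projector_entry i j (affine_lift k r w) \<in> U}"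
proof -
  have "smooth_on (\<lambda>w. projector_entry i j (affine_lift k r w)) UNIV"
    unfolding projector_entry_def
    using smooth_coords_affine_lift[of UNIV k r]
    by (intro smooth_on_divide smooth_on_mult smooth_on_cnj smooth_herm)
      (auto simp: smooth_coords_def herm_self_eq_0 affine_lift_nonzero)
  then show ?thesis
    using open_vimage[OF assms, of "\<lambda>w. projector_entry i j (affine_lift k r w)"]
      smooth_on_imp_continuous_on by (auto simp: vimage_def)
qed

text \<open>For the Hausdorff property, two distinct lines differ in some \<open>projector_entry\<close>, and preimages of disjoint neighbourhoods of the two values are disjoint.\<close>

lemma smooth_manifold_CP3: "smooth_manifold CP3 CP3_atlas"
  unfolding smooth_manifold_def
proof (intro conjI ballI)
  fix c assume "c \<in> CP3_atlas"
  then obtain k r where c: "c = affine_chart k r" "chart_index k r" by (auto simp: CP3_atlas_eq)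
  show "fst c \<subseteq> CP3" by (auto simp: c fst_affine_chart CP3_def)
  show "inj_on (snd c) (fst c)" using inj_on_affine_chart c by simp
  show "open (snd c ` fst c)" using affine_chart_image c by simp
  fix d assume "d \<in> CP3_atlas"
  then obtain k' r' where d: "d = affine_chart k' r'" "chart_index k' r'" by (auto simp: CP3_atlas_eq)
  let ?S = "{w. affine_lift k r w $ k' \<noteq> 0}"
  have "continuous_on UNIV (\<lambda>w. affine_lift k r w $ k')"
    using smooth_coords_affine_lift[of UNIV k r] smooth_on_imp_continuous_on
    by (auto simp: smooth_coords_def)
  then have S: "open ?S" by (intro open_Collect_neq continuous_on_const)
  have im: "snd c ` (fst c \<inter> fst d) = ?S"
    using affine_chart_image_Int[OF c(2)] c d by simp
  show "open (snd c ` (fst c \<inter> fst d))" using S im by simp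
  have "transition c d = (\<lambda>w. affine_coords k' r' (affine_lift k r w))"
    by (rule ext) (simp add: c(1) d(1) transition_affine[OF c(2)])
  then show "smooth_on (transition c d) (snd c ` (fst c \<inter> fst d))"
    unfolding im using smooth_transition[OF S] by simp
next
  have "CP3_atlas \<subseteq> (\<Union>k. range (affine_chart k))" by (auto simp: CP3_atlas_def)
  then have "finite CP3_atlas" by (rule finite_subset) simp
  moreover have "(\<Union>c\<in>CP3_atlas. fst c) = CP3"
  proof
    show "(\<Union>c\<in>CP3_atlas. fst c) \<subseteq> CP3" by (auto simp: CP3_atlas_eq fst_affine_chart CP3_def)
    show "CP3 \<subseteq> (\<Union>c\<in>CP3_atlas. fst c)"
    proof
      fix P assume "P \<in> CP3"
      then obtain p where p: "P = hopf p" "norm p = 1" by (auto simp: CP3_def)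
      then have "p \<noteq> 0" by auto
      then obtain k where "p $ k \<noteq> 0" by (auto simp: vec_eq_iff)
      then have "P \<in> fst (affine_chart k r)" for r
        using hopf_in_affine_chart[OF p(2)] p(1) by simp
      moreover have "\<exists>r. affine_chart k r \<in> CP3_atlas"
        unfolding CP3_atlas_eq using exists_chart_index by blast
      ultimately show "P \<in> (\<Union>c\<in>CP3_atlas. fst c)" by blast
    qed
  qed
  ultimately show "\<exists>B\<subseteq>CP3_atlas. countable B \<and> (\<Union>c\<in>B. fst c) = CP3"
    using countable_finite by blast
next
  have chart: "\<exists>k r. chart_index k r \<and> p $ k \<noteq> 0" if "norm p = 1" for p :: "complex^4"
  proof -
    have "p \<noteq> 0" using that by auto
    then obtain k where "p $ k \<noteq> 0" by (auto simp: vec_eq_iff)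
    then show ?thesis using exists_chart_index by blast
  qed
  fix P Q assume "P \<in> CP3" "Q \<in> CP3"
  then obtain p q where pq: "P = hopf p" "norm p = 1" "Q = hopf q" "norm q = 1" by (auto simp: CP3_def)
  show "P \<noteq> Q \<longrightarrow> (\<exists>c\<in>CP3_atlas. \<exists>d\<in>CP3_atlas. \<exists>N N'.
        open N \<and> open N' \<and> P \<in> fst c \<and> snd c P \<in> N \<and> Q \<in> fst d \<and> snd d Q \<in> N' \<and>
        (fst c \<inter> snd c -` N) \<inter> (fst d \<inter> snd d -` N') = {})"
  proof
    assume "P \<noteq> Q"
    then obtain i j where ij: "projector_entry i j p \<noteq> projector_entry i j q"
      using projector_entry_separates pq by blast
    obtain U V where "open U \<and> open V \<and> projector_entry i j p \<in> U \<and>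
        projector_entry i j q \<in> V \<and> U \<inter> V = {}"
      using hausdorff[OF ij] by (elim exE)
    then have UV: "open U" "open V" "projector_entry i j p \<in> U" "projector_entry i j q \<in> V"
      "U \<inter> V = {}"
      by simp_all
    obtain k r where k: "chart_index k r" "p $ k \<noteq> 0" using chart pq by blast
    obtain k' r' where k': "chart_index k' r'" "q $ k' \<noteq> 0" using chart pq by blast
    let ?c = "affine_chart k r" and ?d = "affine_chart k' r'"
    let ?N = "{w. projector_entry i j (affine_lift k r w) \<in> U}"
    let ?N' = "{w. projector_entry i j (affine_lift k' r' w) \<in> V}"
    have entry: "projector_entry i j (affine_lift l t (snd (affine_chart l t) (hopf s))) =
        projector_entry i j s" if "chart_index l t" "s $ l \<noteq> 0" for l t s
      using that by (simp add: snd_affine_chart_hopf affine_lift_coords projector_entry_scale)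
    have "(fst ?c \<inter> snd ?c -` ?N) \<inter> (fst ?d \<inter> snd ?d -` ?N') = {}"
    proof (rule ccontr)
      assume "(fst ?c \<inter> snd ?c -` ?N) \<inter> (fst ?d \<inter> snd ?d -` ?N') \<noteq> {}"
      then obtain R where R: "R \<in> fst ?c" "snd ?c R \<in> ?N" "R \<in> fst ?d" "snd ?d R \<in> ?N'" by blast
      then obtain s where s: "R = hopf s" "norm s = 1" by (auto simp: fst_affine_chart)
      then have "s $ k \<noteq> 0" "s $ k' \<noteq> 0" using R hopf_in_affine_chart by simp_all
      then have "projector_entry i j s \<in> U \<inter> V"
        using R(2,4) entry k(1) k'(1) s(1) by simp
      then show False using UV(5) by simp
    qed
    moreover have "P \<in> fst ?c" "snd ?c P \<in> ?N" "Q \<in> fst ?d" "snd ?d Q \<in> ?N'"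
      using hopf_in_affine_chart pq k k' entry UV(3,4) by simp_all
    moreover have "?c \<in> CP3_atlas" "?d \<in> CP3_atlas" using k(1) k'(1) by (auto simp: CP3_atlas_eq)
    moreover have "open ?N" "open ?N'"
      by (intro open_projector_entry_vimage UV(1,2))+
    ultimately show "\<exists>c\<in>CP3_atlas. \<exists>d\<in>CP3_atlas. \<exists>N N'.
        open N \<and> open N' \<and> P \<in> fst c \<and> snd c P \<in> N \<and> Q \<in> fst d \<and> snd d Q \<in> N' \<and>
        (fst c \<inter> snd c -` N) \<inter> (fst d \<inter> snd d -` N') = {}"
      by (intro bexI[of _ ?c] bexI[of _ ?d] exI[of _ ?N] exI[of _ ?N']) simp_all
  qed
qed

section \<open>Descent to projective space\<close>

text \<open>Invariance under scaling and vanishing along the complex line through \<open>z\<close>, in one condition. The function \<open>\<psi>\<close> is arbitrary because the multiple of \<open>z\<close> by which two lifts of a tangent vector differ depends on the vector.\<close>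

definition basic_form :: "(complex^4 \<Rightarrow> (complex^4) cform) \<Rightarrow> bool" where
  "basic_form \<eta> \<longleftrightarrow> (\<forall>l z \<psi>. l \<noteq> 0 \<longrightarrow> z \<noteq> 0 \<longrightarrow>
     pull_form (\<lambda>u. l *s u + \<psi> u *s z) (\<eta> (l *s z)) = \<eta> z)"

lemma basic_formD:
  "basic_form \<eta> \<Longrightarrow> l \<noteq> 0 \<Longrightarrow> z \<noteq> 0 \<Longrightarrow>
    pull_form (\<lambda>u. l *s u + \<psi> u *s z) (\<eta> (l *s z)) = \<eta> z"
  by (simp add: basic_form_def)

definition local_expr ::
    "(complex^4 \<Rightarrow> (complex^4) cform) \<Rightarrow> 4 \<Rightarrow> (3 \<Rightarrow> 4) \<Rightarrow> complex^3 \<Rightarrow> (complex^3) cform" where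
  "local_expr \<eta> k r w = pull_form (affine_embed k r) (\<eta> (affine_lift k r w))"

text \<open>Depends on the chart alone, so that the local expressions of different forms are taken along the same lift and can be compared in one frame.\<close>

definition chosen_index :: "((complex^4) set, complex^3) chart \<Rightarrow> 4 \<times> (3 \<Rightarrow> 4)" where
  "chosen_index c = (SOME (k, r). chart_index k r \<and> c = affine_chart k r)"

definition descend :: "(complex^4 \<Rightarrow> (complex^4) cform) \<Rightarrow> ((complex^4) set, complex^3) mform" where
  "descend \<eta> c = local_expr \<eta> (fst (chosen_index c)) (snd (chosen_index c))"

lemma atlas_cases:
  assumes "c \<in> CP3_atlas"
  obtains k r where "chart_index k r" "c = affine_chart k r" "\<And>\<eta>. descend \<eta> c = local_expr \<eta> k r"
    "snd c ` fst c = UNIV"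
proof -
  have "\<exists>x. case x of (k, r) \<Rightarrow> chart_index k r \<and> c = affine_chart k r"
    using assms by (auto simp: CP3_atlas_eq)
  then have "case chosen_index c of (k, r) \<Rightarrow> chart_index k r \<and> c = affine_chart k r"
    unfolding chosen_index_def by (rule someI_ex)
  then show thesis
    using that[of "fst (chosen_index c)" "snd (chosen_index c)"] affine_chart_image
    by (simp add: descend_def split: prod.splits)
qed

lemma smooth_form_local_expr:
  assumes "\<And>z. alternating m (\<eta> z)" "\<And>v. smooth_on (\<lambda>w. \<eta> (affine_lift k r w) v) UNIV"
  shows "smooth_form m UNIV (local_expr \<eta> k r)"
  unfolding smooth_form_def
proof (intro conjI ballI allI)
  show "alternating m (local_expr \<eta> k r x)" for x
    unfolding local_expr_def by (rule alternating_pull[OF linear_affine_embed assms(1)])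
  show "smooth_on (\<lambda>x. local_expr \<eta> k r x v) UNIV" for v
    unfolding local_expr_def pull_form_def by (rule assms(2))
qed

text \<open>Lifting the coordinates of \<open>z\<close> returns a multiple of \<open>z\<close>, and \<open>affine_coords_derivative\<close> says what happens to tangent vectors; the form is basic, so nothing changes. Both the compatibility of charts and the comparison with the sphere are instances.\<close>

lemma local_expr_pull:
  assumes "basic_form \<eta>" "chart_index k r" "z $ k \<noteq> 0"
  obtains D where "(affine_coords k r has_derivative D) (at z)"
    "pull_form D (local_expr \<eta> k r (affine_coords k r z)) = \<eta> z"
proof -
  obtain D where D: "(affine_coords k r has_derivative D) (at z)"
    "\<And>v. affine_embed k r (D v) = (1 / z $ k) *s v + (- (v $ k) / (z $ k)\<^sup>2) *s z"
    using affine_coords_derivative[OF assms(2,3)] by blast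
  have "z \<noteq> 0" using assms(3) by auto
  have "pull_form D (local_expr \<eta> k r (affine_coords k r z)) =
      pull_form (\<lambda>u. (1 / z $ k) *s u + (- (u $ k) / (z $ k)\<^sup>2) *s z) (\<eta> ((1 / z $ k) *s z))"
    unfolding local_expr_def affine_lift_coords[OF assms(2,3)] pull_form_def D(2) ..
  also have "\<dots> = \<eta> z"
    by (rule basic_formD[OF assms(1) _ \<open>z \<noteq> 0\<close>, of "1 / z $ k" "\<lambda>u. - (u $ k) / (z $ k)\<^sup>2"])
      (use assms(3) in simp)
  finally show thesis using that D(1) by blast
qed

lemma affine_lift_derivative: "(affine_lift k r has_derivative affine_embed k r) (at w)"
proof -
  have "bounded_linear (affine_embed k r)"
    using linear_affine_embed linear_conv_bounded_linear by blast
  then have "((\<lambda>w. axis k 1 + affine_embed k r w) has_derivative (\<lambda>v. 0 + affine_embed k r v)) (at w)"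
    by (intro has_derivative_add has_derivative_const bounded_linear_imp_has_derivative)
  then show ?thesis by (simp add: affine_lift_def[abs_def])
qed

lemma manifold_form_descend:
  assumes "basic_form \<eta>" "\<And>z. alternating m (\<eta> z)"
    and "\<And>k r v. smooth_on (\<lambda>w. \<eta> (affine_lift k r w) v) UNIV"
  shows "manifold_form m CP3_atlas (descend \<eta>)"
  unfolding manifold_form_def
proof (intro conjI ballI)
  fix c assume "c \<in> CP3_atlas"
  then obtain k r where c: "chart_index k r" "c = affine_chart k r"
      "\<And>\<eta>. descend \<eta> c = local_expr \<eta> k r" "snd c ` fst c = UNIV"
    by (rule atlas_cases) blast
  show "smooth_form m (snd c ` fst c) (descend \<eta> c)"
    unfolding c(3,4) by (rule smooth_form_local_expr[OF assms(2,3)])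
  fix d x assume "d \<in> CP3_atlas" and x: "x \<in> snd c ` (fst c \<inter> fst d)"
  then obtain k' r' where d: "chart_index k' r'" "d = affine_chart k' r'"
      "\<And>\<eta>. descend \<eta> d = local_expr \<eta> k' r'"
    by (metis atlas_cases)
  let ?z = "affine_lift k r x"
  have z: "?z $ k' \<noteq> 0"
    using x affine_chart_image_Int[OF c(1), of k' r'] c(2) d(2) by simp
  obtain D where D: "(affine_coords k' r' has_derivative D) (at ?z)"
    "pull_form D (local_expr \<eta> k' r' (affine_coords k' r' ?z)) = \<eta> ?z"
    using local_expr_pull[OF assms(1) d(1) z] by blast
  have tr: "transition c d = (\<lambda>w. affine_coords k' r' (affine_lift k r w))"
    by (rule ext) (simp add: c(2) d(2) transition_affine[OF c(1)])
  have "(transition c d has_derivative (\<lambda>v. D (affine_embed k r v))) (at x)"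
    unfolding tr by (rule has_derivative_compose[OF affine_lift_derivative D(1)])
  then have "frechet_derivative (transition c d) (at x) = (\<lambda>v. D (affine_embed k r v))"
    by (metis frechet_derivative_at)
  then have "pull_form (frechet_derivative (transition c d) (at x)) (descend \<eta> d (transition c d x)) =
      pull_form (affine_embed k r) (pull_form D (local_expr \<eta> k' r' (affine_coords k' r' ?z)))"
    by (simp add: d(3) tr pull_form_def)
  also have "\<dots> = descend \<eta> c x"
    by (simp only: D(2) c(3)) (simp only: local_expr_def)
  finally show "descend \<eta> c x =
      pull_form (frechet_derivative (transition c d) (at x)) (descend \<eta> d (transition c d x))" ..
qed

lemma defines_form_descend:
  assumes "basic_form \<eta>" "\<And>z. alternating m (\<eta> z)"
    and "\<And>k r v. smooth_on (\<lambda>w. \<eta> (affine_lift k r w) v) UNIV"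
    and "smooth_form m (- {0}) \<eta>0"
    and "\<And>p v. norm p = 1 \<Longrightarrow> (\<And>i. i < m \<Longrightarrow> inner p (v i) = 0) \<Longrightarrow> \<eta> p v = \<eta>0 p v"
  shows "defines_form m \<eta>0 (descend \<eta>)"
  unfolding defines_form_def
proof (intro conjI ballI impI)
  show "smooth_form m (- {0}) \<eta>0" by fact
  show "manifold_form m CP3_atlas (descend \<eta>)"
    by (rule manifold_form_descend[OF assms(1-3)])
  fix p c assume p: "p \<in> sphere (0::complex^4) 1" and "c \<in> CP3_atlas" and "hopf p \<in> fst c"
  then obtain k r where c: "chart_index k r" "c = affine_chart k r"
      "\<And>\<eta>. descend \<eta> c = local_expr \<eta> k r"
    by (metis atlas_cases)
  have n: "norm p = 1" using p by simp
  then have "p $ k \<noteq> 0" using \<open>hopf p \<in> fst c\<close> hopf_in_affine_chart c(2) by simp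
  then obtain D where D: "(affine_coords k r has_derivative D) (at p)"
    "pull_form D (local_expr \<eta> k r (affine_coords k r p)) = \<eta> p"
    using local_expr_pull[OF assms(1) c(1)] by blast
  have "snd c \<circ> hopf = affine_coords k r"
    by (rule ext) (simp add: c(2) snd_affine_chart_hopf)
  then have "((snd c \<circ> hopf) has_derivative D) (at p within sphere 0 1)"
    using D(1) has_derivative_at_withinI by simp
  moreover have "\<eta>0 p v = pull_form D (descend \<eta> c (snd c (hopf p))) v"
    if "\<forall>i<m. inner p (v i) = 0" for v
    using assms(5)[OF n, of v] that D(2) by (simp add: c(2) c(3)[unfolded c(2)] snd_affine_chart_hopf)
  ultimately show "\<exists>D. ((snd c \<circ> hopf) has_derivative D) (at p within sphere 0 1) \<and>
      (\<forall>v. (\<forall>i<m. inner p (v i) = 0) \<longrightarrow> \<eta>0 p v = pull_form D (descend \<eta> c (snd c (hopf p))) v)"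
    by blast
qed

section \<open>Local decomposability\<close>

text \<open>Near a point \<open>x\<close> let \<open>f\<close> be the projection of a constant vector \<open>u\<close> to the orthogonal complement of \<open>z\<close> and \<open>a\<close>. With \<open>u\<close> itself orthogonal to both at \<open>x\<close>, \<open>f\<close> equals \<open>u\<close> there and remains nonzero nearby.\<close>

lemma locally_decomposable_Omega:
  assumes M: "transpose M = - M" "invertible M" and c: "chart_index k r"
  shows "locally_decomposable 3 UNIV (local_expr (Omega_basic M) k r)"
  unfolding locally_decomposable_def
proof
  fix x :: "complex^3"
  let ?z = "affine_lift k r" and ?L = "affine_embed k r"
  let ?a = "\<lambda>y. alpha_dual M (?z y)"
  have nz: "?z y \<noteq> 0" "?a y \<noteq> 0" for y
    using affine_lift_nonzero alpha_dual_nonzero[OF M(2)] by blast+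
  then have hnz: "herm (?z y) (?z y) \<noteq> 0" "herm (?a y) (?a y) \<noteq> 0" for y
    by (simp_all add: herm_self_eq_0)
  have za: "herm (?z y) (?a y) = 0" "herm (?a y) (?z y) = 0" for y
    using herm_alpha_dual_self[OF M(1)] herm_cnj by (metis complex_cnj_zero)+
  obtain u where u: "u \<noteq> 0" "herm (?z x) u = 0" "herm (?a x) u = 0"
    using exists_orthogonal[of "?z x" "?a x" "?a x"] by blast
  define f where "f y = u - (herm u (?z y) / herm (?z y) (?z y)) *s ?z y
      - (herm u (?a y) / herm (?a y) (?a y)) *s ?a y" for y
  have "herm (f y) (?z y) = 0" "herm (f y) (?a y) = 0" for y
    using hnz za by (simp_all add: f_def herm_diff herm_scale)
  then have f_orth: "herm (?z y) (f y) = 0" "herm (?a y) (f y) = 0" for y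
    using herm_cnj by (metis complex_cnj_zero)+
  have "herm u (?z x) = 0" "herm u (?a x) = 0"
    using u(2,3) herm_cnj by (metis complex_cnj_zero)+
  then have fx: "f x = u" by (simp add: f_def)
  have z_sm: "smooth_coords ?z UNIV" by (rule smooth_coords_affine_lift[OF open_UNIV])
  have a_sm: "smooth_coords ?a UNIV" by (rule smooth_alpha_dual[OF open_UNIV z_sm])
  have f_sm: "smooth_coords f S" if "open S" for S
    using smooth_coords_affine_lift[OF that, of k r] smooth_alpha_dual[OF that, of ?z M]
    unfolding smooth_coords_def f_def vector_minus_component vector_smult_component
    using hnz
    by (intro allI smooth_on_diff smooth_on_mult smooth_on_divide smooth_herm smooth_on_const that)
      (auto simp: smooth_coords_def smooth_on_const that)
  define N where "N = {y. herm (f y) (f y) \<noteq> 0}"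
  have "continuous_on UNIV (\<lambda>y. herm (f y) (f y))"
    by (intro smooth_on_imp_continuous_on smooth_herm f_sm open_UNIV)
  then have N: "open N" unfolding N_def by (intro open_Collect_neq continuous_on_const)
  have xN: "x \<in> N" using u(1) by (simp add: N_def fx herm_self_eq_0)
  \<comment> \<open>all scalar factors are absorbed into the first one-form\<close>
  define s where "s y = 1 / (herm (?a y) (?a y) * herm (f y) (f y) * (herm (?z y) (?z y))\<^sup>2)" for y
  define t :: "complex^3 \<Rightarrow> nat \<Rightarrow> complex^3 \<Rightarrow> complex" where
    "t y = (!) [\<lambda>w. s y * cnj (herm (?L w) (?a y)), \<lambda>w. herm (?L w) (f y), \<lambda>w. vol (?z y) (?a y) (f y) (?L w)]" for y
  define \<theta> :: "nat \<Rightarrow> complex^3 \<Rightarrow> (complex^3) cform" where "\<theta> i y v = t y i (v 0)" for i y v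
  have dec: "local_expr (Omega_basic M) k r y = wedge_one_forms 3 (\<lambda>i. \<theta> i y)" if "y \<in> N" for y
  proof
    fix v
    have f0: "f y \<noteq> 0" using that by (auto simp: N_def)
    have "local_expr (Omega_basic M) k r y v = s y * wedge_list [\<lambda>w. cnj (herm w (?a y)), \<lambda>w. herm w (f y),
        \<lambda>w. vol (?z y) (?a y) (f y) w] (\<lambda>i. ?L (v i))"
      by (simp add: local_expr_def pull_form_def Omega_basic_def
          Omega_form_decomposed[OF f0 f_orth] s_def)
    also have "\<dots> = s y * 1 * 1 * wedge_list [\<lambda>w. cnj (herm (?L w) (?a y)), \<lambda>w. herm (?L w) (f y),
        \<lambda>w. vol (?z y) (?a y) (f y) (?L w)] v"
      using fun_cong[OF wedge_list_pull[of ?L "[\<lambda>w. cnj (herm w (?a y)), \<lambda>w. herm w (f y),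
        \<lambda>w. vol (?z y) (?a y) (f y) w]"], of v] by (simp add: pull_form_def)
    also have "\<dots> = wedge_list [t y 0, t y 1, t y 2] v"
      unfolding wedge_list_scale3[symmetric] by (simp add: t_def)
    also have "\<dots> = wedge_one_forms 3 (\<lambda>i. \<theta> i y) v"
      unfolding \<theta>_def wedge_one_forms_eq_wedge_list by (simp add: upt_rec numeral_2_eq_2)
    finally show "local_expr (Omega_basic M) k r y v = wedge_one_forms 3 (\<lambda>i. \<theta> i y) v" .
  qed
  have Ldisj: "i = 0 \<or> i = 1 \<or> i = 2" if "i < 3" for i :: nat using that by auto
  have lin: "linear (t y i)" if "i < 3" for y i
    using Ldisj[OF that] linear_cmult[OF linear_compose[OF linear_affine_embed linear_cnj_herm]]
      linear_compose[OF linear_affine_embed linear_herm] linear_compose[OF linear_affine_embed linear_vol]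
    by (auto simp: t_def o_def)
  have alt: "alternating 1 (\<theta> i y)" if "i < 3" for i y
    using alternating_wedge_list[of "[t y i]"] lin[OF that] by (simp add: wedge_list_single \<theta>_def[abs_def])
  have zN: "smooth_coords ?z N" and aN: "smooth_coords ?a N" and fN: "smooth_coords f N"
    using smooth_coords_affine_lift[OF N] smooth_alpha_dual[OF N] f_sm[OF N] by blast+
  have s_sm: "smooth_on s N"
    unfolding s_def using hnz
    by (intro smooth_on_divide smooth_on_mult smooth_on_power smooth_herm smooth_on_const N zN aN fN)
      (auto simp: N_def)
  have sm: "smooth_on (\<lambda>y. \<theta> i y v) N" if "i < 3" for i v
  proof -
    have "smooth_on (\<lambda>y. s y * cnj (herm (?L (v 0)) (?a y))) N"
      "smooth_on (\<lambda>y. herm (?L (v 0)) (f y)) N"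
      "smooth_on (\<lambda>y. vol (?z y) (?a y) (f y) (?L (v 0))) N"
      by (intro smooth_on_mult smooth_on_cnj smooth_herm smooth_vol s_sm smooth_coords_const N zN aN fN)+
    then show ?thesis using Ldisj[OF that] by (auto simp: \<theta>_def t_def)
  qed
  show "\<exists>N \<theta>. open N \<and> x \<in> N \<and> N \<subseteq> UNIV \<and> (\<forall>i<3. smooth_form 1 N (\<theta> i)) \<and>
      (\<forall>y\<in>N. local_expr (Omega_basic M) k r y = wedge_one_forms 3 (\<lambda>i. \<theta> i y))"
    using N xN dec alt sm unfolding smooth_form_def
    by (intro exI[of _ N] exI[of _ \<theta>]) simp
qed

section \<open>The holomorphic twist form\<close>

text \<open>The bilinear expression read as a function of the point; this gives its derivative at once.\<close>

lemma alpha_form_linear_in_point: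
  "alpha_form M z v = herm z (\<chi> i. cnj (\<Sum>j\<in>UNIV. M $ i $ j * v 0 $ j))"
  by (simp add: alpha_form_def dz_def herm_def sum_distrib_left mult_ac)

lemma frechet_derivative_linear: "bounded_linear f \<Longrightarrow> frechet_derivative f (at x) = f"
  by (metis bounded_linear_imp_has_derivative frechet_derivative_at)

lemma holomorphic_twist_form_alpha:
  assumes M: "transpose M = - M" "invertible M"
  shows "holomorphic_twist_form 2 (alpha_form M)"
  unfolding holomorphic_twist_form_def
proof (intro conjI ballI)
  have in_z: "bounded_linear (\<lambda>y. alpha_form M y v)" for v
    using linear_herm linear_conv_bounded_linear unfolding alpha_form_linear_in_point by blast
  have scale_z: "alpha_form M (c *s z) v = c * alpha_form M z v" for c z v
    by (simp add: alpha_form_linear_in_point herm_scale)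
  show "holomorphic_one_form (- {0}) (alpha_form M)"
    unfolding holomorphic_one_form_def
  proof (intro conjI ballI allI)
    show "alternating 1 (alpha_form M z)" for z
    proof -
      have "alpha_form M z = wedge_list [\<lambda>u. herm u (alpha_dual M z)]"
        by (rule ext) (simp add: wedge_list_single alpha_form_eq)
      then show ?thesis
        using alternating_wedge_list[of "[\<lambda>u. herm u (alpha_dual M z)]"] linear_herm[of "alpha_dual M z"]
        by simp
    qed
    show "alpha_form M z (\<lambda>i. c *s v i) = c * alpha_form M z v" for z c v
      by (simp add: alpha_form_eq herm_scale)
    show "\<exists>D. ((\<lambda>y. alpha_form M y v) has_derivative D) (at z) \<and> (\<forall>c h. D (c *s h) = c * D h)" for v z
      using bounded_linear_imp_has_derivative[OF in_z] scale_z by blast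
  qed
  fix z :: "complex^4" assume z: "z \<in> - {0}"
  have s: "alpha_dual M z \<noteq> 0" using alpha_dual_nonzero[OF M(2)] z by simp
  show "alpha_form M z \<noteq> (\<lambda>v. 0)"
  proof
    assume "alpha_form M z = (\<lambda>v. 0)"
    then have "herm (alpha_dual M z) (alpha_dual M z) = 0"
      using alpha_form_eq[of M z "\<lambda>_. alpha_dual M z"] by simp
    then show False using s by (simp add: herm_self_eq_0)
  qed
  show "interior10 (euler z) (alpha_form M z) = (\<lambda>v. 0)"
    by (simp add: interior10_def interior_def alpha_form_eq euler_def herm_scale
        herm_alpha_dual_self[OF M(1)] fun_eq_iff)
  show "lie_derivative10 1 euler (alpha_form M) z = (\<lambda>v. of_nat 2 * alpha_form M z v)"
  proof
    fix v :: "nat \<Rightarrow> complex^4"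
    \<comment> \<open>one summand comes from the point, the other from the vector; the cases c = 1 and c = i combine to the (1,0)-field\<close>
    have lie: "lie_derivative 1 (\<lambda>y. c *s y) (alpha_form M) z v = 2 * c * alpha_form M z v" for c
    proof -
      have "linear (\<lambda>y::complex^4. c *s y)"
        by (intro linearI) (simp_all add: vec_eq_iff algebra_simps)
      then have "frechet_derivative (\<lambda>y::complex^4. c *s y) (at z) = (\<lambda>y. c *s y)"
        by (intro frechet_derivative_linear) (simp add: linear_conv_bounded_linear)
      then show ?thesis
        by (simp add: lie_derivative_def frechet_derivative_linear[OF in_z] scale_z)
          (simp add: alpha_form_eq herm_scale)
    qed
    have "euler = (\<lambda>y. 1 *s y)" "(\<lambda>y. \<i> *s euler y) = (\<lambda>y. \<i> *s y)"
      by (simp_all add: euler_def fun_eq_iff)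
    then show "lie_derivative10 1 euler (alpha_form M) z v = of_nat 2 * alpha_form M z v"
      using lie[of 1] lie[of \<i>] by (simp add: lie_derivative10_def)
  qed
qed

section \<open>The SU(3)-structure\<close>

lemma basic_form_Omega: "transpose M = - M \<Longrightarrow> basic_form (Omega_basic M)"
  unfolding basic_form_def using Omega_basic_invariant by blast

lemma basic_form_omega: "transpose M = - M \<Longrightarrow> basic_form (omega_basic M)"
  unfolding basic_form_def using omega_basic_invariant by blast

lemma smooth_coords_ident: "open S \<Longrightarrow> smooth_coords (\<lambda>z. z) S"
  unfolding smooth_coords_def by (intro allI smooth_on_linear bounded_linear_vec_nth)

lemma defines_form_Omega:
  assumes M: "transpose M = - M" "invertible M"
  shows "defines_form 3 (Omega_form M) (descend (Omega_basic M))"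
proof (rule defines_form_descend)
  show "smooth_form 3 (- {0}) (Omega_form M)"
    unfolding smooth_form_def
    using smooth_Omega_form[OF open_Compl[OF closed_singleton] smooth_coords_ident _ M(2)] alternating_Omega_form by auto
  show "smooth_on (\<lambda>w. Omega_basic M (affine_lift k r w) v) UNIV" for k r v
    by (intro smooth_Omega_basic smooth_coords_affine_lift affine_lift_nonzero open_UNIV M(2))
qed (simp_all add: basic_form_Omega[OF M(1)] alternating_Omega_basic Omega_basic_on_sphere)

lemma defines_form_omega:
  assumes M: "transpose M = - M" "invertible M"
  shows "defines_form 2 (omega_form M) (descend (omega_basic M))"
proof (rule defines_form_descend)
  show "smooth_form 2 (- {0}) (omega_form M)"
    unfolding smooth_form_def
    using smooth_omega_form[OF open_Compl[OF closed_singleton] smooth_coords_ident _ M(2)] alternating_omega_form by auto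
  show "smooth_on (\<lambda>w. omega_basic M (affine_lift k r w) v) UNIV" for k r v
    by (intro smooth_omega_basic smooth_coords_affine_lift affine_lift_nonzero open_UNIV M(2))
qed (simp_all add: basic_form_omega[OF M(1)] alternating_omega_basic omega_basic_on_sphere)

text \<open>The coframe at the lifted point, restricted along the lift. Its kernel in \<open>\<complex>\<^sup>4\<close> is the line through the lifted point, whose \<open>k\<close>-th coordinate is 1, whereas tangent vectors of the affine slice have \<open>k\<close>-th coordinate 0.\<close>

lemma local_frame:
  assumes M: "transpose M = - M" "invertible M" and c: "chart_index k r"
  obtains t0 t1 t2 :: "complex^3 \<Rightarrow> complex" where "linear t0" "linear t1" "linear t2"
    "\<And>u. t0 u = 0 \<Longrightarrow> t1 u = 0 \<Longrightarrow> t2 u = 0 \<Longrightarrow> u = 0"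
    "local_expr (Omega_basic M) k r x = wedge_list [t0, t1, t2]"
    "local_expr (omega_basic M) k r x = fundamental_form [t0, t1, t2]"
proof -
  let ?z = "affine_lift k r x" and ?L = "affine_embed k r"
  obtain t0 t1 t2 where t: "linear t0" "linear t1" "linear t2"
    "Omega_basic M ?z = wedge_list [t0, t1, t2]" "omega_basic M ?z = fundamental_form [t0, t1, t2]"
    "\<And>u. t0 u = 0 \<Longrightarrow> t1 u = 0 \<Longrightarrow> t2 u = 0 \<Longrightarrow> \<exists>c. u = c *s ?z"
    using unitary_frame[OF M affine_lift_nonzero] by blast
  show thesis
  proof (rule that)
    show "linear (\<lambda>u. t0 (?L u))" "linear (\<lambda>u. t1 (?L u))" "linear (\<lambda>u. t2 (?L u))"
      using linear_compose[OF linear_affine_embed] t(1-3) by (auto simp: o_def)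
    show "local_expr (Omega_basic M) k r x =
        wedge_list [\<lambda>u. t0 (?L u), \<lambda>u. t1 (?L u), \<lambda>u. t2 (?L u)]"
      by (simp add: local_expr_def t(4) wedge_list_pull)
    show "local_expr (omega_basic M) k r x =
        fundamental_form [\<lambda>u. t0 (?L u), \<lambda>u. t1 (?L u), \<lambda>u. t2 (?L u)]"
      by (simp add: local_expr_def t(5) pull_form_def fundamental_form_eq fun_eq_iff)
    fix u assume "t0 (?L u) = 0" "t1 (?L u) = 0" "t2 (?L u) = 0"
    then obtain c where cz: "?L u = c *s ?z" using t(6) by blast
    have "?L u $ k = 0" by (simp add: affine_embed_def)
    then have "c = 0" using cz by (simp add: affine_lift_nth)
    then have L0: "?L u = 0" using cz by simp
    have "u $ j = ?L u $ r j" for j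
      by (simp add: affine_embed_def chart_indexD[OF c])
    then show "u = 0" using L0 by (simp add: vec_eq_iff)
  qed
qed

theorem theorem5:
  fixes M :: "complex^4^4"
  assumes "transpose M = - M" and "invertible M"
  shows "holomorphic_twist_form 2 (alpha_form M) \<and>
    (\<exists>\<Omega> \<omega>. defines_form 3 (Omega_form M) \<Omega> \<and> defines_form 2 (omega_form M) \<omega> \<and>
       SU_structure CP3 CP3_atlas 3 \<Omega> \<omega>)"
proof (intro conjI exI)
  let ?\<Omega> = "descend (Omega_basic M)" and ?\<omega> = "descend (omega_basic M)"
  show "holomorphic_twist_form 2 (alpha_form M)" by (rule holomorphic_twist_form_alpha[OF assms])
  show \<Omega>: "defines_form 3 (Omega_form M) ?\<Omega>" by (rule defines_form_Omega[OF assms])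
  show \<omega>: "defines_form 2 (omega_form M) ?\<omega>" by (rule defines_form_omega[OF assms])
  show "SU_structure CP3 CP3_atlas 3 ?\<Omega> ?\<omega>"
    unfolding SU_structure_def
  proof (intro conjI ballI)
    show "smooth_manifold CP3 CP3_atlas" by (rule smooth_manifold_CP3)
    show "DIM(complex^3) = 2 * 3" by simp
    show "manifold_form 3 CP3_atlas ?\<Omega>" "manifold_form 2 CP3_atlas ?\<omega>"
      using \<Omega> \<omega> by (simp_all add: defines_form_def)
    fix c assume "c \<in> CP3_atlas"
    then obtain k r where c: "chart_index k r" "\<And>\<eta>. descend \<eta> c = local_expr \<eta> k r"
      "snd c ` fst c = UNIV"
      by (rule atlas_cases) blast
    show "locally_decomposable 3 (snd c ` fst c) (?\<Omega> c)"
      unfolding c(2,3) by (rule locally_decomposable_Omega[OF assms c(1)])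
    fix x
    obtain t0 t1 t2 where t: "linear t0" "linear t1" "linear t2"
      "\<And>u. t0 u = 0 \<Longrightarrow> t1 u = 0 \<Longrightarrow> t2 u = 0 \<Longrightarrow> u = 0"
      "?\<Omega> c x = wedge_list [t0, t1, t2]" "?\<omega> c x = fundamental_form [t0, t1, t2]"
      unfolding c(2) by (rule local_frame[OF assms c(1)]) blast
    note SU3 = SU3_conditions[OF t(1-4)]
    show "\<forall>v. ?\<omega> c x v \<in> \<real>" "\<forall>u. u \<noteq> 0 \<longrightarrow> interior u (?\<omega> c x) \<noteq> (\<lambda>v. 0)"
      "?\<Omega> c x \<noteq> (\<lambda>v. 0)" "wedge 3 2 (?\<Omega> c x) (?\<omega> c x) = (\<lambda>v. 0)"
      "wedge 3 3 (?\<Omega> c x) (conj_form (?\<Omega> c x)) = (\<lambda>v. SU_const 3 * two_form_power 3 (?\<omega> c x) v)"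
      unfolding t(5,6) using SU3 by blast+
  qed
qed

end
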